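(* Let $q\in\mathbb R$, $q\neq0$, $q^2\ne1$, and let $g=\mathrm{diag}(g_{++},g_{00},g_{--})$ be a non-degenerate Hermitian metric on $\Omega^1\mathbb C_q[SU_2]$ (nonzero real constant entries). Among the left invariant, right $\mathbb{CZ}$-invariant bimodule covariant derivatives on $\Omega^1\mathbb C_q[SU_2]$ that preserve $g$, are torsion compatible and star compatible, there are precisely two for which $\sigma$ obeys the braid relations $(\sigma\otimes\mathrm{id})(\mathrm{id}\otimes\sigma)(\sigma\otimes\mathrm{id})=(\mathrm{id}\otimes\sigma)(\sigma\otimes\mathrm{id})(\mathrm{id}\otimes\sigma)$, namely $$r\in\Big\{0,\ \frac{2}{q^2-1}\Big\},\quad n_+=\frac{1+q^2}{q^4},\quad n_-=-(1+q^2),\quad m_+=m_-=\nu=\mu=0.$$ For these, $\sigma$ has the following eigenvectors and eigenvalues: $q^2e^+\otimes e^-+e^-\otimes e^+$, eigenvalue $1$; $q^2e^+\otimes e^--e^-\otimes e^+$, eigenvalue $-1$; $e^0\otimes e^0$, eigenvalue $+1$ for $r=0$ and $-1$ for $r=2/(q^2-1)$; $q^2e^+\otimes e^0+q^{-2}e^0\otimes e^+$, eigenvalue $1$; $q^2e^+\otimes e^0-q^{-2}e^0\otimes e^+$, eigenvalue $-1$; $q^4e^0\otimes e^-+e^-\otimes e^0$, eigenvalue $1$; $q^4e^0\otimes e^--e^-\otimes e^0$, eigenvalue $-1$; $e^+\otimes e^+$, eigenvalue $q^2$; $e^-\otimes e^-$, eigenvalue $q^{-2}$. These connections are never torsion free.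 The case $r=0$ is the unique such connection having a limit as $q\to1$ (i.e. its coefficients $r,\nu,\mu,n_\pm,m_\pm$ converge).
   Context: **Algebra and calculus.** Let $q\in\mathbb R$, $q\ne0$, $q^2\neq1$. $A=\mathbb C_q[SU_2]$ is the unital $*$-algebra with generators $a,b,c,d$ and relations $ba=qab$, $ca=qac$, $db=qbd$, $dc=qcd$, $cb=bc$, $da-ad=q(1-q^{-2})bc$, $ad-q^{-1}bc=1$, with $a^*=d$, $d^*=a$, $c^*=-qb$, $b^*=-q^{-1}c$. Its 3D calculus: $\Omega^1A$ is the free left $A$-module on $e^+,e^0,e^-$, with bimodule relations $e^\pm a=qae^\pm$, $e^\pm c=qce^\pm$, $e^\pm b=q^{-1}be^\pm$, $e^\pm d=q^{-1}de^\pm$, $e^0a=q^2ae^0$, $e^0c=q^2ce^0$, $e^0b=q^{-2}be^0$, $e^0d=q^{-2}de^0$, and derivation $\mathrm d:A\to\Omega^1A$, $\mathrm da=ae^0+qbe^+$, $\mathrm db=ae^--q^{-2}be^0$, $\mathrm dc=ce^0+qde^+$, $\mathrm dd=ce^--q^{-2}de^0$. The star on $\Omega^1A$ is antilinear with $(x\xi y)^*=y^*\xi^*x^*$, $(e^0)^*=-e^0$, $(e^+)^*=-q^{-1}e^-$, $(e^-)^*=-qe^+$. In $\Omega^2A$: $e^\pm\wedge e^\pm=e^0\wedge e^0=0$, $q^2e^+\wedge e^-+e^-\wedge e^+=0$, $e^0\wedge e^\pm+q^{\pm4}e^\pm\wedge e^0=0$ (so $\Omega^2A$ is free on $e^+\wedge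 e^-,e^+\wedge e^0,e^-\wedge e^0$), and $\mathrm de^0=q^3e^+\wedge e^-$, $\mathrm de^\pm=\mp q^{\pm2}(1+q^{-2})e^\pm\wedge e^0$. **Connections.** A bimodule covariant derivative on $\Omega^1A$ is a linear map $\nabla:\Omega^1A\to\Omega^1A\otimes_A\Omega^1A$ with $\nabla(x\xi)=\mathrm dx\otimes\xi+x\nabla\xi$, together with a bimodule map $\sigma:\Omega^1A\otimes_A\Omega^1A\to\Omega^1A\otimes_A\Omega^1A$ with $\nabla(\xi x)=\nabla(\xi)x+\sigma(\xi\otimes\mathrm dx)$. The left invariant, right $\mathbb{CZ}$-invariant ones are those of the form (with $r,\nu,\mu,n_\pm,m_\pm\in\mathbb C$) $$\nabla e^0=r\,e^0\otimes e^0+\nu\,e^+\otimes e^-+\mu\,e^-\otimes e^+,\qquad \nabla e^\pm=n_\pm\,e^0\otimes e^\pm+m_\pm\,e^\pm\otimes e^0,$$ with $\sigma(e^0\otimes e^0)=(1+r(1-q^2))e^0\otimes e^0$, $\sigma(e^\pm\otimes e^0)=(1+(1-q^2)n_\pm)e^0\otimes e^\pm+(1-q^2)m_\pm e^\pm\otimes e^0$, $\sigma(e^0\otimes e^\pm)=q^{\pm4}e^\pm\otimes e^0$, $\sigma(e^{i}\otimes e^\pm)=q^{\pm2}e^\pm\otimes e^{i}$ for $i\in\{+,-\}$. **Conditions.** Torsion is $T=\wedge\nabla-\mathrm d:\Omega^1A\to\Omega^2A$; torsion free means $T=0$; torsion compatible means $\wedge\circ(\mathrm{id}+\sigma)=0$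 (equivalently $T$ is a bimodule map). Star compatible means $\sigma$ is invertible and $\sigma\tau\sigma=\tau$, where $\tau(\xi\otimes\eta)=\eta^*\otimes\xi^*$. The metric $g$ with matrix $(g_{ij})=\mathrm{diag}(g_{++},g_{00},g_{--})$ and inverse $(g^{ij})$ is the Hermitian structure determined by $\langle e^i,\overline{e^j}\rangle=g^{ij}$ and $\langle x\xi,\overline{y\eta}\rangle=x\langle\xi,\overline\eta\rangle y^*$. Writing $\nabla e^i=-\sum_k\Gamma^i_k\otimes e^k$, $\nabla$ preserves $g$ means $\sum_j\big((\Gamma^j_i)^*g_{jk}+g_{ij}\Gamma^j_k\big)=0$ for all $i,k\in\{+,0,-\}$ (this is the vanishing of the covariant derivative of $\sum_{i,j}\overline{e^j}g_{ji}\otimes e^i$). *)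

theory Defs
  imports Complex_Main "HOL-Library.FuncSet" "HOL-Algebra.QuotRing"
begin

datatype gen = Ga | Gb | Gc | Gd

text \<open>The free unital complex algebra on the four generators: finitely supported functions on
  words with the concatenation (convolution) product.\<close>

definition free_alg :: "(gen list \<Rightarrow> complex) ring" where
  "free_alg =
    \<lparr>carrier = {f. finite {w. f w \<noteq> 0}},
     mult = (\<lambda>f g w. \<Sum>k\<le>length w. f (take k w) * g (drop k w)),
     one = (\<lambda>w. if w = [] then 1 else 0),
     zero = (\<lambda>w. 0),
     add = (\<lambda>f g w. f w + g w)\<rparr>"

definition comb :: "(complex \<times> gen list) list \<Rightarrow> gen list \<Rightarrow> complex" where
  "comb cs w = (\<Sum>(z, v)\<leftarrow>cs. if v = w then z else 0)"

type_synonym alg = "(gen list \<Rightarrow> complex) set"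

datatype idx = Ep | E0 | Em

datatype idx2 = Epm | Ep0 | Em0

record coeffs =
  c_r :: complex
  c_nu :: complex
  c_mu :: complex
  c_np :: complex
  c_nm :: complex
  c_mp :: complex
  c_mm :: complex

definition coeffs_converge :: "('a \<Rightarrow> coeffs) \<Rightarrow> 'a filter \<Rightarrow> bool" where
  "coeffs_converge C F \<longleftrightarrow>
    (\<forall>f \<in> {c_r, c_nu, c_mu, c_np, c_nm, c_mp, c_mm}. \<exists>L. ((\<lambda>x. f (C x)) \<longlongrightarrow> L) F)"

definition diag_mat :: "('i \<Rightarrow> real) \<Rightarrow> 'i \<Rightarrow> 'i \<Rightarrow> real" where
  "diag_mat g i j = (if i = j then g i else 0)"

context
  fixes q :: real
begin

definition rels :: "(gen list \<Rightarrow> complex) set" where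
  "rels =
    {comb [(1, [Gb, Ga]), (-q, [Ga, Gb])],
     comb [(1, [Gc, Ga]), (-q, [Ga, Gc])],
     comb [(1, [Gd, Gb]), (-q, [Gb, Gd])],
     comb [(1, [Gd, Gc]), (-q, [Gc, Gd])],
     comb [(1, [Gc, Gb]), (-1, [Gb, Gc])],
     comb [(1, [Gd, Ga]), (-1, [Ga, Gd]), (-(q * (1 - 1 / q\<^sup>2)), [Gb, Gc])],
     comb [(1, [Ga, Gd]), (-(1 / q), [Gb, Gc]), (-1, [])]}"

definition su2 :: "alg ring" where
  "su2 = free_alg Quot (Idl\<^bsub>free_alg\<^esub> rels)"

definition cls :: "(gen list \<Rightarrow> complex) \<Rightarrow> alg" where
  "cls f = (Idl\<^bsub>free_alg\<^esub> rels) +>\<^bsub>free_alg\<^esub> f"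

definition gen :: "gen \<Rightarrow> alg" where
  "gen x = cls (comb [(1, [x])])"

definition cst :: "complex \<Rightarrow> alg" where
  "cst z = cls (comb [(z, [])])"

definition cgen :: "complex \<Rightarrow> gen \<Rightarrow> alg" where
  "cgen z x = cst z \<otimes>\<^bsub>su2\<^esub> gen x"

text \<open>Linear extension of a map given on words. Maps out of the quotient are evaluated on
  representatives: \<^const>\<open>the_elem\<close> of the image of a coset.\<close>

definition lin_ext :: "(gen list \<Rightarrow> alg) \<Rightarrow> (gen list \<Rightarrow> complex) \<Rightarrow> alg" where
  "lin_ext \<phi> f = (\<Oplus>\<^bsub>su2\<^esub>w\<in>{w. f w \<noteq> 0}. cst (f w) \<otimes>\<^bsub>su2\<^esub> \<phi> w)"

fun star_gen :: "gen \<Rightarrow> alg" where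
  "star_gen Ga = gen Gd"
| "star_gen Gb = cgen (-(1 / q)) Gc"
| "star_gen Gc = cgen (-q) Gb"
| "star_gen Gd = gen Ga"

fun star_word :: "gen list \<Rightarrow> alg" where
  "star_word [] = \<one>\<^bsub>su2\<^esub>"
| "star_word (x # w) = star_word w \<otimes>\<^bsub>su2\<^esub> star_gen x"

definition star :: "alg \<Rightarrow> alg" where
  "star X = the_elem ((\<lambda>f. lin_ext star_word (\<lambda>w. cnj (f w))) ` X)"

text \<open>The free left module on a finite index type; an element is its coefficient family.
  \<open>idx\<close> gives the one-forms. Since these are free as a left module, their tensor powers over the
  algebra are free on the pairs and triples of basis forms; \<open>idx2\<close> gives the two-forms.\<close>

definition fmod :: "('i \<Rightarrow> alg) set" where
  "fmod = {\<xi>. \<forall>i. \<xi> i \<in> carrier su2}"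

definition mzero :: "'i \<Rightarrow> alg" where
  "mzero = (\<lambda>i. \<zero>\<^bsub>su2\<^esub>)"

definition madd :: "('i \<Rightarrow> alg) \<Rightarrow> ('i \<Rightarrow> alg) \<Rightarrow> 'i \<Rightarrow> alg" where
  "madd \<xi> \<eta> = (\<lambda>i. \<xi> i \<oplus>\<^bsub>su2\<^esub> \<eta> i)"

definition mdiff :: "('i \<Rightarrow> alg) \<Rightarrow> ('i \<Rightarrow> alg) \<Rightarrow> 'i \<Rightarrow> alg" where
  "mdiff \<xi> \<eta> = (\<lambda>i. \<xi> i \<ominus>\<^bsub>su2\<^esub> \<eta> i)"

definition lmul :: "alg \<Rightarrow> ('i \<Rightarrow> alg) \<Rightarrow> 'i \<Rightarrow> alg" where
  "lmul x \<xi> = (\<lambda>i. x \<otimes>\<^bsub>su2\<^esub> \<xi> i)"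

definition smul :: "complex \<Rightarrow> ('i \<Rightarrow> alg) \<Rightarrow> 'i \<Rightarrow> alg" where
  "smul z = lmul (cst z)"

definition msum :: "('j \<Rightarrow> 'i \<Rightarrow> alg) \<Rightarrow> 'i \<Rightarrow> alg" where
  "msum F = (\<lambda>i. \<Oplus>\<^bsub>su2\<^esub>j\<in>UNIV. F j i)"

definition bas :: "'i \<Rightarrow> 'i \<Rightarrow> alg" where
  "bas i = (\<lambda>j. if j = i then \<one>\<^bsub>su2\<^esub> else \<zero>\<^bsub>su2\<^esub>)"

definition lext :: "('i \<Rightarrow> 'j \<Rightarrow> alg) \<Rightarrow> ('i \<Rightarrow> alg) \<Rightarrow> 'j \<Rightarrow> alg" where
  "lext B \<xi> = msum (\<lambda>i. lmul (\<xi> i) (B i))"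

text \<open>The bimodule relations: \<open>e\<^sup>i x = bim i x \<cdot> x e\<^sup>i\<close> for a generator \<open>x\<close>, hence
  \<open>e\<^sup>i x = (twist i x) e\<^sup>i\<close> for all \<open>x\<close> with \<open>twist i\<close> multiplicative.\<close>

fun bim :: "idx \<Rightarrow> gen \<Rightarrow> complex" where
  "bim i Ga = (if i = E0 then q\<^sup>2 else q)"
| "bim i Gc = (if i = E0 then q\<^sup>2 else q)"
| "bim i Gb = (if i = E0 then 1 / q\<^sup>2 else 1 / q)"
| "bim i Gd = (if i = E0 then 1 / q\<^sup>2 else 1 / q)"

fun twist_word :: "idx \<Rightarrow> gen list \<Rightarrow> alg" where
  "twist_word i [] = \<one>\<^bsub>su2\<^esub>"
| "twist_word i (x # w) = cgen (bim i x) x \<otimes>\<^bsub>su2\<^esub> twist_word i w"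

definition twist :: "idx \<Rightarrow> alg \<Rightarrow> alg" where
  "twist i X = the_elem (lin_ext (twist_word i) ` X)"

definition rmul :: "(idx \<Rightarrow> alg) \<Rightarrow> alg \<Rightarrow> idx \<Rightarrow> alg" where
  "rmul \<xi> x = (\<lambda>i. \<xi> i \<otimes>\<^bsub>su2\<^esub> twist i x)"

definition rmul2 :: "(idx \<times> idx \<Rightarrow> alg) \<Rightarrow> alg \<Rightarrow> idx \<times> idx \<Rightarrow> alg" where
  "rmul2 \<omega> x = (\<lambda>(i, j). \<omega> (i, j) \<otimes>\<^bsub>su2\<^esub> twist i (twist j x))"

text \<open>Tensor products over the algebra, from \<open>x e\<^sup>i \<otimes> y e\<^sup>j = x (twist i y) e\<^sup>i \<otimes> e\<^sup>j\<close>.\<close>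

definition tens :: "(idx \<Rightarrow> alg) \<Rightarrow> (idx \<Rightarrow> alg) \<Rightarrow> idx \<times> idx \<Rightarrow> alg" where
  "tens \<xi> \<eta> = (\<lambda>(i, j). \<xi> i \<otimes>\<^bsub>su2\<^esub> twist i (\<eta> j))"

definition tens12 :: "(idx \<Rightarrow> alg) \<Rightarrow> (idx \<times> idx \<Rightarrow> alg) \<Rightarrow> idx \<times> idx \<times> idx \<Rightarrow> alg" where
  "tens12 \<xi> \<omega> = (\<lambda>(i, j, k). \<xi> i \<otimes>\<^bsub>su2\<^esub> twist i (\<omega> (j, k)))"

definition tens21 :: "(idx \<times> idx \<Rightarrow> alg) \<Rightarrow> (idx \<Rightarrow> alg) \<Rightarrow> idx \<times> idx \<times> idx \<Rightarrow> alg" where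
  "tens21 \<omega> \<eta> = (\<lambda>(i, j, k). \<omega> (i, j) \<otimes>\<^bsub>su2\<^esub> twist i (twist j (\<eta> k)))"

definition ee :: "idx \<Rightarrow> idx \<Rightarrow> idx \<times> idx \<Rightarrow> alg" where
  "ee i j = tens (bas i) (bas j)"

text \<open>The derivation: given on generators and extended to words by the Leibniz rule.\<close>

fun d_gen :: "gen \<Rightarrow> idx \<Rightarrow> alg" where
  "d_gen Ga = madd (lmul (gen Ga) (bas E0)) (lmul (cgen q Gb) (bas Ep))"
| "d_gen Gb = madd (lmul (gen Ga) (bas Em)) (lmul (cgen (-(1 / q\<^sup>2)) Gb) (bas E0))"
| "d_gen Gc = madd (lmul (gen Gc) (bas E0)) (lmul (cgen q Gd) (bas Ep))"
| "d_gen Gd = madd (lmul (gen Gc) (bas Em)) (lmul (cgen (-(1 / q\<^sup>2)) Gd) (bas E0))"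

fun d_word :: "gen list \<Rightarrow> idx \<Rightarrow> alg" where
  "d_word [] = mzero"
| "d_word (x # w) = madd (rmul (d_gen x) (cls (comb [(1, w)]))) (lmul (gen x) (d_word w))"

definition d :: "alg \<Rightarrow> idx \<Rightarrow> alg" where
  "d X = (\<lambda>i. the_elem (lin_ext (\<lambda>w. d_word w i) ` X))"

fun star_bas :: "idx \<Rightarrow> idx \<Rightarrow> alg" where
  "star_bas E0 = smul (-1) (bas E0)"
| "star_bas Ep = smul (-(1 / q)) (bas Em)"
| "star_bas Em = smul (-q) (bas Ep)"

text \<open>\<open>(\<Sum> x\<^sub>i e\<^sup>i)\<^sup>* = \<Sum> (e\<^sup>i)\<^sup>* x\<^sub>i\<^sup>*\<close>, and \<open>\<tau> (\<xi> \<otimes> \<eta>) = \<eta>\<^sup>* \<otimes> \<xi>\<^sup>*\<close> evaluated on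
  \<open>\<omega> = \<Sum> (\<omega>\<^sub>i\<^sub>j e\<^sup>i) \<otimes> e\<^sup>j\<close>.\<close>

definition star1 :: "(idx \<Rightarrow> alg) \<Rightarrow> idx \<Rightarrow> alg" where
  "star1 \<xi> = msum (\<lambda>i. rmul (star_bas i) (star (\<xi> i)))"

definition tau :: "(idx \<times> idx \<Rightarrow> alg) \<Rightarrow> idx \<times> idx \<Rightarrow> alg" where
  "tau \<omega> = msum (\<lambda>(i, j). tens (star1 (bas j)) (star1 (lmul (\<omega> (i, j)) (bas i))))"

text \<open>The exterior product, with the two-forms free on
  \<open>e\<^sup>+ \<and> e\<^sup>-\<close> (\<open>Epm\<close>), \<open>e\<^sup>+ \<and> e\<^sup>0\<close> (\<open>Ep0\<close>) and \<open>e\<^sup>- \<and> e\<^sup>0\<close> (\<open>Em0\<close>).\<close>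

fun wedge_bas :: "idx \<times> idx \<Rightarrow> idx2 \<Rightarrow> alg" where
  "wedge_bas (Ep, Em) = bas Epm"
| "wedge_bas (Em, Ep) = smul (-(q\<^sup>2)) (bas Epm)"
| "wedge_bas (Ep, E0) = bas Ep0"
| "wedge_bas (E0, Ep) = smul (-(q ^ 4)) (bas Ep0)"
| "wedge_bas (Em, E0) = bas Em0"
| "wedge_bas (E0, Em) = smul (-(1 / q ^ 4)) (bas Em0)"
| "wedge_bas (Ep, Ep) = mzero"
| "wedge_bas (E0, E0) = mzero"
| "wedge_bas (Em, Em) = mzero"

definition wedge :: "(idx \<times> idx \<Rightarrow> alg) \<Rightarrow> idx2 \<Rightarrow> alg" where
  "wedge = lext wedge_bas"

fun d1_bas :: "idx \<Rightarrow> idx2 \<Rightarrow> alg" where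
  "d1_bas E0 = smul (q ^ 3) (bas Epm)"
| "d1_bas Ep = smul (-(q\<^sup>2 * (1 + 1 / q\<^sup>2))) (bas Ep0)"
| "d1_bas Em = smul (1 / q\<^sup>2 * (1 + 1 / q\<^sup>2)) (bas Em0)"

text \<open>\<open>d (x e\<^sup>i) = d x \<and> e\<^sup>i + x d e\<^sup>i\<close>.\<close>

definition d1 :: "(idx \<Rightarrow> alg) \<Rightarrow> idx2 \<Rightarrow> alg" where
  "d1 \<xi> = msum (\<lambda>i. madd (wedge (tens (d (\<xi> i)) (bas i))) (lmul (\<xi> i) (d1_bas i)))"

type_synonym conn = "(idx \<Rightarrow> alg) \<Rightarrow> idx \<times> idx \<Rightarrow> alg"
type_synonym braiding = "(idx \<times> idx \<Rightarrow> alg) \<Rightarrow> idx \<times> idx \<Rightarrow> alg"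

text \<open>Maps are taken extensional on their domain, so that equality of maps is equality of
  functions and connections can be counted.\<close>

definition bimodule_conn :: "conn \<Rightarrow> braiding \<Rightarrow> bool" where
  "bimodule_conn nabla \<sigma> \<longleftrightarrow>
    nabla \<in> fmod \<rightarrow>\<^sub>E fmod \<and>
    (\<forall>\<xi>\<in>fmod. \<forall>\<eta>\<in>fmod. nabla (madd \<xi> \<eta>) = madd (nabla \<xi>) (nabla \<eta>)) \<and>
    (\<forall>z. \<forall>\<xi>\<in>fmod. nabla (smul z \<xi>) = smul z (nabla \<xi>)) \<and>
    (\<forall>x\<in>carrier su2. \<forall>\<xi>\<in>fmod. nabla (lmul x \<xi>) = madd (tens (d x) \<xi>) (lmul x (nabla \<xi>))) \<and>
    \<sigma> \<in> fmod \<rightarrow>\<^sub>E fmod \<and>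
    (\<forall>\<omega>\<in>fmod. \<forall>\<rho>\<in>fmod. \<sigma> (madd \<omega> \<rho>) = madd (\<sigma> \<omega>) (\<sigma> \<rho>)) \<and>
    (\<forall>x\<in>carrier su2. \<forall>\<omega>\<in>fmod. \<sigma> (lmul x \<omega>) = lmul x (\<sigma> \<omega>)) \<and>
    (\<forall>x\<in>carrier su2. \<forall>\<omega>\<in>fmod. \<sigma> (rmul2 \<omega> x) = rmul2 (\<sigma> \<omega>) x) \<and>
    (\<forall>x\<in>carrier su2. \<forall>\<xi>\<in>fmod. nabla (rmul \<xi> x) = madd (rmul2 (nabla \<xi>) x) (\<sigma> (tens \<xi> (d x))))"

text \<open>The left invariant, right \<open>\<complex>\<int>\<close>-invariant bimodule covariant derivatives are exactly the bimodule
  covariant derivatives of this form, with coefficients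
  \<open>r, \<nu>, \<mu>, n\<^sub>+, n\<^sub>-, m\<^sub>+, m\<^sub>-\<close> in the order of the record fields.\<close>

definition has_coeffs :: "coeffs \<Rightarrow> conn \<Rightarrow> braiding \<Rightarrow> bool" where
  "has_coeffs C nabla \<sigma> \<longleftrightarrow>
    nabla (bas E0) = madd (smul (c_r C) (ee E0 E0))
      (madd (smul (c_nu C) (ee Ep Em)) (smul (c_mu C) (ee Em Ep))) \<and>
    nabla (bas Ep) = madd (smul (c_np C) (ee E0 Ep)) (smul (c_mp C) (ee Ep E0)) \<and>
    nabla (bas Em) = madd (smul (c_nm C) (ee E0 Em)) (smul (c_mm C) (ee Em E0)) \<and>
    \<sigma> (ee E0 E0) = smul (1 + c_r C * (1 - q\<^sup>2)) (ee E0 E0) \<and>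
    \<sigma> (ee Ep E0) = madd (smul (1 + (1 - q\<^sup>2) * c_np C) (ee E0 Ep))
      (smul ((1 - q\<^sup>2) * c_mp C) (ee Ep E0)) \<and>
    \<sigma> (ee Em E0) = madd (smul (1 + (1 - q\<^sup>2) * c_nm C) (ee E0 Em))
      (smul ((1 - q\<^sup>2) * c_mm C) (ee Em E0)) \<and>
    \<sigma> (ee E0 Ep) = smul (q ^ 4) (ee Ep E0) \<and>
    \<sigma> (ee E0 Em) = smul (1 / q ^ 4) (ee Em E0) \<and>
    (\<forall>i\<in>{Ep, Em}. \<sigma> (ee i Ep) = smul (q\<^sup>2) (ee Ep i)) \<and>
    (\<forall>i\<in>{Ep, Em}. \<sigma> (ee i Em) = smul (1 / q\<^sup>2) (ee Em i))"

definition invariant_conn :: "conn \<Rightarrow> braiding \<Rightarrow> bool" where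
  "invariant_conn nabla \<sigma> \<longleftrightarrow> bimodule_conn nabla \<sigma> \<and> (\<exists>C. has_coeffs C nabla \<sigma>)"

definition torsion :: "conn \<Rightarrow> (idx \<Rightarrow> alg) \<Rightarrow> idx2 \<Rightarrow> alg" where
  "torsion nabla \<xi> = mdiff (wedge (nabla \<xi>)) (d1 \<xi>)"

definition torsion_free :: "conn \<Rightarrow> bool" where
  "torsion_free nabla \<longleftrightarrow> (\<forall>\<xi>\<in>fmod. torsion nabla \<xi> = mzero)"

definition torsion_compatible :: "braiding \<Rightarrow> bool" where
  "torsion_compatible \<sigma> \<longleftrightarrow> (\<forall>\<omega>\<in>fmod. wedge (madd \<omega> (\<sigma> \<omega>)) = mzero)"

definition star_compatible :: "braiding \<Rightarrow> bool" where
  "star_compatible \<sigma> \<longleftrightarrow> bij_betw \<sigma> fmod fmod \<and> (\<forall>\<omega>\<in>fmod. \<sigma> (tau (\<sigma> \<omega>)) = tau \<omega>)"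

text \<open>\<open>christ nabla i k\<close> is the one-form \<open>\<Gamma>\<^sup>i\<^sub>k\<close> in \<open>\<nabla> e\<^sup>i = - \<Sum>\<^sub>k \<Gamma>\<^sup>i\<^sub>k \<otimes> e\<^sup>k\<close>.\<close>

definition christ :: "conn \<Rightarrow> idx \<Rightarrow> idx \<Rightarrow> idx \<Rightarrow> alg" where
  "christ nabla i k = (\<lambda>j. \<ominus>\<^bsub>su2\<^esub> nabla (bas i) (j, k))"

text \<open>Only the matrix of the metric occurs: the Hermitian structure is determined by it, and the
  condition below is the vanishing of the covariant derivative of
  \<open>\<Sum>\<^sub>i\<^sub>j (conjugate of e\<^sup>j) g\<^sub>j\<^sub>i \<otimes> e\<^sup>i\<close>.\<close>

definition preserves :: "conn \<Rightarrow> (idx \<Rightarrow> idx \<Rightarrow> real) \<Rightarrow> bool" where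
  "preserves nabla g \<longleftrightarrow>
    (\<forall>i k. msum (\<lambda>j. madd (smul (g j k) (star1 (christ nabla j i)))
                          (smul (g i j) (christ nabla j k))) = mzero)"

text \<open>\<open>\<sigma> \<otimes> id\<close> and \<open>id \<otimes> \<sigma>\<close> are left linear, hence given by their values on \<open>e\<^sup>i \<otimes> e\<^sup>j \<otimes> e\<^sup>k\<close>.\<close>

definition sigma_id :: "braiding \<Rightarrow> (idx \<times> idx \<times> idx \<Rightarrow> alg) \<Rightarrow> idx \<times> idx \<times> idx \<Rightarrow> alg" where
  "sigma_id \<sigma> = lext (\<lambda>(i, j, k). tens21 (\<sigma> (ee i j)) (bas k))"

definition id_sigma :: "braiding \<Rightarrow> (idx \<times> idx \<times> idx \<Rightarrow> alg) \<Rightarrow> idx \<times> idx \<times> idx \<Rightarrow> alg" where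
  "id_sigma \<sigma> = lext (\<lambda>(i, j, k). tens12 (bas i) (\<sigma> (ee j k)))"

definition braid_relation :: "braiding \<Rightarrow> bool" where
  "braid_relation \<sigma> \<longleftrightarrow>
    (\<forall>\<omega>\<in>fmod. sigma_id \<sigma> (id_sigma \<sigma> (sigma_id \<sigma> \<omega>)) = id_sigma \<sigma> (sigma_id \<sigma> (id_sigma \<sigma> \<omega>)))"

definition braided_conns :: "(idx \<Rightarrow> idx \<Rightarrow> real) \<Rightarrow> (conn \<times> braiding) set" where
  "braided_conns g = {(nabla, \<sigma>). invariant_conn nabla \<sigma> \<and> preserves nabla g \<and>
     torsion_compatible \<sigma> \<and> star_compatible \<sigma> \<and> braid_relation \<sigma>}"

definition eigenvector :: "braiding \<Rightarrow> (idx \<times> idx \<Rightarrow> alg) \<Rightarrow> complex \<Rightarrow> bool" where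
  "eigenvector \<sigma> \<omega> z \<longleftrightarrow> \<omega> \<in> fmod \<and> \<omega> \<noteq> mzero \<and> \<sigma> \<omega> = smul z \<omega>"

end

end

(*
  Constant multiples of the basis vectors behave like vectors of complex numbers, because the scalars
  are central and embed into the algebra (the counit sends a, d to 1 and b, c to 0). On them sigma is
  a flip e^i (x) e^j |-> flip e^j (x) e^i plus terms stay e^+- (x) e^0, and every condition becomes an
  equation between complex numbers. Torsion compatibility expresses the two stay coefficients by
  flip(+,0) and flip(-,0), star compatibility relates these two, and one coefficient of the braid
  relation is a multiple of the product of the stay coefficients. Hence both vanish, which determines
  everything except the sign flip(0,0); the metric only forces r to be real and nu = mu = 0.

  Conversely, write t_i for the twist by e^i and D_k for the e^k-component of d. Then
  D_0 = (t_0 - id) / (q^2 - 1), and D_k t_i = flip(i,k) t_i D_k for k = +, -. With these rules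
  nabla xi = sum over k, l of (D_k xi_l + rho_kl xi_l) e^k (x) e^l is a bimodule connection, where
  rho_kl is nonzero only for k = 0. A flip with scalar coefficients always satisfies the braid
  relation.
*)

theory Submission
  imports Defs
begin

subsection \<open>The free algebra\<close>

text \<open>The algebra is a quotient of a free algebra, and star, twist and derivation are defined
  by evaluating a linear extension on all representatives of a coset, so each of them must first be
  shown to descend. Each is lifted to the free algebra, where it obeys a possibly twisted product
  rule; the elements of the relation ideal that it kills then form an ideal, and only the seven
  relations remain to be checked. Linear independence is needed for scalars alone, hence the counit
  suffices: necessity is tested on constant tensors, and sufficiency rests on identities that
  propagate along products.

  The values n_+ and n_- solve 1 + (1 - q^2) n = q^(-4) and 1 + (1 - q^2) n = q^4, which make the
  flips of e^+ and e^- past e^0 inverse to the flips back; r comes from 1 + (1 - q^2) r = 1 or -1.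
  The braid relation isolates the product of the stay coefficients because only one of its sides
  leads from e^+ (x) e^- (x) e^0 to e^- (x) e^+ (x) e^0, and it does so by two stays and one nonzero
  flip.\<close>

abbreviation fmon :: "complex \<Rightarrow> gen list \<Rightarrow> gen list \<Rightarrow> complex" where
  "fmon z w \<equiv> comb [(z, w)]"

lemma fmon_apply: "fmon z w v = (if w = v then z else 0)"
  by (simp add: comb_def)

lemma comb_Nil: "comb [] = (\<lambda>w. 0)"
  by (auto simp: comb_def)

lemma comb_Cons: "comb ((z, w) # cs) = (\<lambda>v. fmon z w v + comb cs v)"
  by (auto simp: comb_def)

lemma free_add: "f \<oplus>\<^bsub>free_alg\<^esub> g = (\<lambda>w. f w + g w)"
  by (simp add: free_alg_def)

lemma free_zero: "\<zero>\<^bsub>free_alg\<^esub> = (\<lambda>w. 0)"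
  by (simp add: free_alg_def)

lemma free_one: "\<one>\<^bsub>free_alg\<^esub> = fmon 1 []"
  by (auto simp: free_alg_def comb_def)

lemma free_carrier: "f \<in> carrier free_alg \<longleftrightarrow> finite {w. f w \<noteq> 0}"
  by (simp add: free_alg_def)

lemma free_mult: "(f \<otimes>\<^bsub>free_alg\<^esub> g) w = (\<Sum>k\<le>length w. f (take k w) * g (drop k w))"
  by (simp add: free_alg_def)

lemma free_add_closed:
  "f \<in> carrier free_alg \<Longrightarrow> g \<in> carrier free_alg \<Longrightarrow> f \<oplus>\<^bsub>free_alg\<^esub> g \<in> carrier free_alg"
  unfolding free_carrier free_add
  by (rule finite_subset[of _ "{w. f w \<noteq> 0} \<union> {w. g w \<noteq> 0}"]) auto

lemma comb_closed [simp]: "comb cs \<in> carrier free_alg"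
proof (induction cs)
  case Nil
  then show ?case by (simp add: comb_Nil free_carrier)
next
  case (Cons a cs)
  obtain z w where a: "a = (z, w)" by fastforce
  have "fmon z w \<in> carrier free_alg"
    unfolding free_carrier by (rule finite_subset[of _ "{w}"]) (auto simp: fmon_apply)
  then show ?case
    using free_add_closed[OF _ Cons] by (simp add: a comb_Cons[of z w cs] free_add)
qed

text \<open>A word in the support of a product is a concatenation of words from the two finite
  supports.\<close>

lemma free_mult_closed:
  assumes "f \<in> carrier free_alg" "g \<in> carrier free_alg"
  shows "f \<otimes>\<^bsub>free_alg\<^esub> g \<in> carrier free_alg"
proof -
  have "{w. (f \<otimes>\<^bsub>free_alg\<^esub> g) w \<noteq> 0} \<subseteq> (\<lambda>(u, v). u @ v) ` ({w. f w \<noteq> 0} \<times> {w. g w \<noteq> 0})"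
  proof
    fix w assume "w \<in> {w. (f \<otimes>\<^bsub>free_alg\<^esub> g) w \<noteq> 0}"
    then obtain k where "f (take k w) * g (drop k w) \<noteq> 0"
      unfolding free_mult by (auto elim: sum.not_neutral_contains_not_neutral)
    then show "w \<in> (\<lambda>(u, v). u @ v) ` ({w. f w \<noteq> 0} \<times> {w. g w \<noteq> 0})"
      by (intro image_eqI[of _ _ "(take k w, drop k w)"]) auto
  qed
  moreover have "finite ((\<lambda>(u, v). u @ v) ` ({w. f w \<noteq> 0} \<times> {w. g w \<noteq> 0}))"
    using assms unfolding free_carrier by (intro finite_imageI finite_cartesian_product)
  ultimately show ?thesis
    unfolding free_carrier by (rule finite_subset)
qed

text \<open>Both sides run over the triples i + j + k = n. The induction splits off the triples with
  k = 0, and the shift of k in the others is absorbed by generalising over \<open>F\<close>.\<close>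

lemma sum_split_twice:
  fixes F :: "nat \<Rightarrow> nat \<Rightarrow> nat \<Rightarrow> 'a::comm_monoid_add"
  shows "(\<Sum>j\<le>n. \<Sum>i\<le>j. F i (j - i) (n - j)) = (\<Sum>j\<le>n. \<Sum>i\<le>n - j. F j i (n - j - i))"
proof (induction n arbitrary: F)
  case (Suc n)
  show ?case
    using Suc[of "\<lambda>i j k. F i j (Suc k)"] by (simp add: Suc_diff_le sum.distrib add.assoc)
qed simp

lemma free_assoc: "f \<otimes>\<^bsub>free_alg\<^esub> g \<otimes>\<^bsub>free_alg\<^esub> h = f \<otimes>\<^bsub>free_alg\<^esub> (g \<otimes>\<^bsub>free_alg\<^esub> h)"
proof
  fix w :: "gen list"
  let ?n = "length w"
  let ?F = "\<lambda>i j k::nat. f (take i w) * g (take j (drop i w)) * h (drop (i + j) w)"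
  have "(f \<otimes>\<^bsub>free_alg\<^esub> g \<otimes>\<^bsub>free_alg\<^esub> h) w = (\<Sum>j\<le>?n. \<Sum>i\<le>j. ?F i (j - i) (?n - j))"
    unfolding free_mult sum_distrib_right
    by (intro sum.cong refl) (simp_all add: min.absorb1 min.absorb2 drop_take)
  also have "\<dots> = (\<Sum>j\<le>?n. \<Sum>i\<le>?n - j. ?F j i (?n - j - i))"
    by (rule sum_split_twice)
  also have "\<dots> = (f \<otimes>\<^bsub>free_alg\<^esub> (g \<otimes>\<^bsub>free_alg\<^esub> h)) w"
    by (simp add: free_mult sum_distrib_left mult.assoc add.commute)
  finally show "(f \<otimes>\<^bsub>free_alg\<^esub> g \<otimes>\<^bsub>free_alg\<^esub> h) w = (f \<otimes>\<^bsub>free_alg\<^esub> (g \<otimes>\<^bsub>free_alg\<^esub> h)) w" .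
qed

lemma fmon_mult: "fmon z v \<otimes>\<^bsub>free_alg\<^esub> fmon z' w = fmon (z * z') (v @ w)"
proof
  fix u
  \<comment> \<open>Only the cut of \<open>u\<close> after \<open>length v\<close> letters can
    contribute.\<close>
  have "(fmon z v \<otimes>\<^bsub>free_alg\<^esub> fmon z' w) u =
      (\<Sum>k\<le>length u. if k = length v \<and> v @ w = u then z * z' else 0)"
    unfolding free_mult fmon_apply
    by (intro sum.cong) (auto simp: append_eq_conv_conj)
  also have "\<dots> = fmon (z * z') (v @ w) u"
    by (cases "v @ w = u") (auto simp: fmon_apply)
  finally show "(fmon z v \<otimes>\<^bsub>free_alg\<^esub> fmon z' w) u = fmon (z * z') (v @ w) u" .
qed

lemma free_one_mult: "fmon z [] \<otimes>\<^bsub>free_alg\<^esub> f = (\<lambda>w. z * f w)"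
proof
  fix w :: "gen list"
  have "(fmon z [] \<otimes>\<^bsub>free_alg\<^esub> f) w = (\<Sum>k\<le>length w. if k = 0 then z * f w else 0)"
    unfolding free_mult fmon_apply by (intro sum.cong) auto
  then show "(fmon z [] \<otimes>\<^bsub>free_alg\<^esub> f) w = z * f w" by simp
qed

lemma free_mult_one: "f \<otimes>\<^bsub>free_alg\<^esub> fmon z [] = (\<lambda>w. z * f w)"
proof
  fix w :: "gen list"
  have "(f \<otimes>\<^bsub>free_alg\<^esub> fmon z []) w = (\<Sum>k\<le>length w. if k = length w then z * f w else 0)"
    unfolding free_mult fmon_apply by (intro sum.cong) auto
  then show "(f \<otimes>\<^bsub>free_alg\<^esub> fmon z []) w = z * f w" by simp
qed

lemma ring_free: "ring free_alg"
proof (rule ringI)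
  show "abelian_group free_alg"
  proof (rule abelian_groupI)
    fix f assume "f \<in> carrier free_alg"
    then show "\<exists>g\<in>carrier free_alg. g \<oplus>\<^bsub>free_alg\<^esub> f = \<zero>\<^bsub>free_alg\<^esub>"
      by (intro bexI[of _ "\<lambda>w. - f w"]) (auto simp: free_add free_zero free_carrier)
  qed (auto simp: free_add_closed, auto simp: free_add free_zero free_carrier algebra_simps)
  show "monoid free_alg"
    by (rule monoidI)
      (auto simp: free_mult_closed free_assoc free_one free_one_mult free_mult_one)
next
  fix f g h
  show "(f \<oplus>\<^bsub>free_alg\<^esub> g) \<otimes>\<^bsub>free_alg\<^esub> h = f \<otimes>\<^bsub>free_alg\<^esub> h \<oplus>\<^bsub>free_alg\<^esub> g \<otimes>\<^bsub>free_alg\<^esub> h"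
    by (rule ext) (simp add: free_mult free_add distrib_right sum.distrib)
  show "h \<otimes>\<^bsub>free_alg\<^esub> (f \<oplus>\<^bsub>free_alg\<^esub> g) = h \<otimes>\<^bsub>free_alg\<^esub> f \<oplus>\<^bsub>free_alg\<^esub> h \<otimes>\<^bsub>free_alg\<^esub> g"
    by (rule ext) (simp add: free_mult free_add distrib_left sum.distrib)
qed

interpretation F: ring free_alg
  by (rule ring_free)

lemma comb_Cons_add: "comb ((z, w) # cs) = fmon z w \<oplus>\<^bsub>free_alg\<^esub> comb cs"
  by (simp only: comb_Cons[of z w cs] free_add)

lemma comb_Nil_zero: "comb [] = \<zero>\<^bsub>free_alg\<^esub>"
  by (simp add: comb_Nil free_zero)

text \<open>The induction runs over a finite set containing the support, so the coefficient of the
  word split off may be zero and no case distinction arises.\<close>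

lemma free_induct [consumes 1, case_names zero add]:
  assumes "f \<in> carrier free_alg"
    and "P \<zero>\<^bsub>free_alg\<^esub>"
    and "\<And>z w f. f \<in> carrier free_alg \<Longrightarrow> P f \<Longrightarrow> P (fmon z w \<oplus>\<^bsub>free_alg\<^esub> f)"
  shows "P f"
proof -
  have "\<And>f. {w. f w \<noteq> 0} \<subseteq> B \<Longrightarrow> P f" if "finite B" for B
    using that
  proof (induction B rule: finite_induct)
    case empty
    then have "f = \<zero>\<^bsub>free_alg\<^esub>" by (auto simp: free_zero)
    then show ?case using assms(2) by simp
  next
    case (insert u B)
    let ?h = "\<lambda>w. if w = u then 0 else f w"
    have *: "{w. ?h w \<noteq> 0} \<subseteq> B" using insert.prems by auto
    have "f = fmon (f u) u \<oplus>\<^bsub>free_alg\<^esub> ?h"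
      by (auto simp: free_add fmon_apply)
    moreover have "?h \<in> carrier free_alg"
      using finite_subset[OF * insert.hyps(1)] by (simp only: free_carrier)
    ultimately show ?case
      using assms(3)[of ?h "f u" u] insert.IH[OF *] by simp
  qed
  then show ?thesis using assms(1) free_carrier by blast
qed

text \<open>The counit is needed only to show that scalars embed into the quotient.\<close>

definition word_char :: "gen list \<Rightarrow> complex" where
  "word_char w = (if set w \<subseteq> {Ga, Gd} then 1 else 0)"

definition counit :: "(gen list \<Rightarrow> complex) \<Rightarrow> complex" where
  "counit f = (\<Sum>w | f w \<noteq> 0. f w * word_char w)"

text \<open>Supports can shrink under addition; sums over a common finite superset make additivity a
  termwise matter.\<close>

lemma counit_superset:
  assumes "finite B" "{w. f w \<noteq> 0} \<subseteq> B"
  shows "counit f = (\<Sum>w\<in>B. f w * word_char w)"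
  unfolding counit_def by (rule sum.mono_neutral_left[OF assms]) auto

lemma counit_add:
  assumes "f \<in> carrier free_alg" "g \<in> carrier free_alg"
  shows "counit (f \<oplus>\<^bsub>free_alg\<^esub> g) = counit f + counit g"
proof -
  let ?B = "{w. f w \<noteq> 0} \<union> {w. g w \<noteq> 0}"
  have B: "finite ?B" using assms by (auto simp: free_carrier)
  show ?thesis
    by (subst (1 2 3) counit_superset[OF B]) (auto simp: free_add algebra_simps sum.distrib)
qed

lemma counit_fmon: "counit (fmon z w) = z * word_char w"
  by (subst counit_superset[of "{w}"]) (auto simp: fmon_apply)

lemma counit_zero: "counit \<zero>\<^bsub>free_alg\<^esub> = 0"
  by (simp add: counit_def free_zero)

lemma counit_comb: "counit (comb cs) = (\<Sum>(z, w)\<leftarrow>cs. z * word_char w)"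
proof (induction cs)
  case Nil
  then show ?case by (simp add: comb_Nil_zero counit_zero)
next
  case (Cons a cs)
  obtain z w where a: "a = (z, w)" by fastforce
  show ?case
    unfolding a comb_Cons_add[of z w cs] using Cons by (simp add: counit_add counit_fmon)
qed

lemma word_char_append: "word_char (v @ w) = word_char v * word_char w"
  by (auto simp: word_char_def)

text \<open>Reduces a product rule to monomials. The predicate \<open>P\<close> is left abstract so
  that counit, derivation and star, whose rules differ in shape, share the reduction.\<close>

lemma biadditive_free_eq:
  assumes "f \<in> carrier free_alg" "g \<in> carrier free_alg"
    and "\<And>g. g \<in> carrier free_alg \<Longrightarrow> P \<zero>\<^bsub>free_alg\<^esub> g"
    and "\<And>f. f \<in> carrier free_alg \<Longrightarrow> P f \<zero>\<^bsub>free_alg\<^esub>"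
    and "\<And>f f' g. \<lbrakk>f \<in> carrier free_alg; f' \<in> carrier free_alg; g \<in> carrier free_alg; P f g; P f' g\<rbrakk>
      \<Longrightarrow> P (f \<oplus>\<^bsub>free_alg\<^esub> f') g"
    and "\<And>f g g'. \<lbrakk>f \<in> carrier free_alg; g \<in> carrier free_alg; g' \<in> carrier free_alg; P f g; P f g'\<rbrakk>
      \<Longrightarrow> P f (g \<oplus>\<^bsub>free_alg\<^esub> g')"
    and "\<And>z z' v w. P (fmon z v) (fmon z' w)"
  shows "P f g"
  using assms(1)
proof (induction f rule: free_induct)
  case zero
  then show ?case using assms by simp
next
  case (add z v f)
  have "P (fmon z v) g"
    using assms(2) by (induction g rule: free_induct) (use assms in simp_all)
  then show ?case using add assms by simp
qed

lemma counit_mult: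
  assumes "f \<in> carrier free_alg" "g \<in> carrier free_alg"
  shows "counit (f \<otimes>\<^bsub>free_alg\<^esub> g) = counit f * counit g"
  using assms
  by (rule biadditive_free_eq)
    (auto simp: counit_zero F.l_distr F.r_distr counit_add algebra_simps fmon_mult counit_fmon
      word_char_append)

section \<open>The quotient algebra and its projection\<close>

locale qsu2 =
  fixes q :: real
  assumes q_nz: "q \<noteq> 0"
begin

abbreviation relI where "relI \<equiv> Idl\<^bsub>free_alg\<^esub> (rels q)"
abbreviation add2 (infixl \<open>\<boxplus>\<close> 65) where "x \<boxplus> y \<equiv> x \<oplus>\<^bsub>su2 q\<^esub> y"
abbreviation mult2 (infixl \<open>\<boxdot>\<close> 70) where "x \<boxdot> y \<equiv> x \<otimes>\<^bsub>su2 q\<^esub> y"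
abbreviation "zer \<equiv> \<zero>\<^bsub>su2 q\<^esub>"
abbreviation "S \<equiv> carrier (su2 q)"

lemma rels_closed: "rels q \<subseteq> carrier free_alg"
  by (simp add: rels_def)

lemma ideal_relI: "ideal relI free_alg"
  by (rule F.genideal_ideal[OF rels_closed])

lemma ring_su2: "ring (su2 q)"
  unfolding su2_def by (rule ideal.quotient_is_ring[OF ideal_relI])

sublocale S: ring "su2 q"
  by (rule ring_su2)

lemma cls_hom: "cls q \<in> ring_hom free_alg (su2 q)"
  using ideal.rcos_ring_hom[OF ideal_relI] unfolding su2_def cls_def .

sublocale cls: ring_hom_ring free_alg "su2 q" "cls q"
  by (rule ring_hom_ringI2[OF ring_free ring_su2 cls_hom])

lemma cls_surj:
  assumes "x \<in> S"
  obtains f where "f \<in> carrier free_alg" "x = cls q f"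
  using assms by (auto simp: su2_def cls_def FactRing_def A_RCOSETS_defs a_r_coset_def)

lemma cls_eq_zero_iff:
  assumes "f \<in> carrier free_alg"
  shows "cls q f = zer \<longleftrightarrow> f \<in> relI"
proof -
  have "zer = relI" by (simp add: su2_def FactRing_def)
  then show ?thesis
    using F.a_rcos_zero[OF ideal_relI, of f] ideal.rcos_const_imp_mem[OF ideal_relI assms]
    by (auto simp: cls_def)
qed

text \<open>The kernel of a multiplicative functional is an ideal, and it contains the generators of
  \<open>relI\<close>.\<close>

lemma counit_vanishes: "f \<in> relI \<Longrightarrow> counit f = 0"
proof -
  let ?J = "{f \<in> carrier free_alg. counit f = 0}"
  have "counit (\<ominus>\<^bsub>free_alg\<^esub> f) = - counit f" if "f \<in> carrier free_alg" for f
    using that counit_add[of f "\<ominus>\<^bsub>free_alg\<^esub> f"]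
    by (simp add: F.r_neg counit_zero eq_neg_iff_add_eq_0 add.commute)
  then have "subgroup ?J (add_monoid free_alg)"
    by (intro F.add.subgroupI)
      (auto simp: counit_add a_inv_def[symmetric] intro!: exI[of _ "\<zero>\<^bsub>free_alg\<^esub>"] counit_zero)
  then have "ideal ?J free_alg"
    by (intro idealI ring_free) (auto simp: counit_mult)
  moreover have "rels q \<subseteq> ?J"
    using q_nz by (auto simp: rels_def counit_comb word_char_def)
  ultimately show "f \<in> relI \<Longrightarrow> counit f = 0"
    using F.genideal_minimal by blast
qed

subsection \<open>Scalars\<close>

lemma cst_closed [simp]: "cst q z \<in> S"
  by (simp add: cst_def)

text \<open>The counit separates scalars in the quotient. Every comparison of coefficients below
  rests on this.\<close>

lemma cst_eq_zero_iff: "cst q z = zer \<longleftrightarrow> z = 0"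
proof
  assume "cst q z = zer"
  then have "counit (fmon z []) = 0"
    by (intro counit_vanishes) (simp add: cst_def cls_eq_zero_iff)
  then show "z = 0" by (simp add: counit_fmon word_char_def)
next
  have "fmon 0 [] = \<zero>\<^bsub>free_alg\<^esub>" by (auto simp: fmon_apply free_zero)
  then show "z = 0 \<Longrightarrow> cst q z = zer" by (simp add: cst_def)
qed

lemma cst_0 [simp]: "cst q 0 = zer"
  by (simp add: cst_eq_zero_iff)

lemma cst_1 [simp]: "cst q 1 = \<one>\<^bsub>su2 q\<^esub>"
  by (simp add: cst_def free_one[symmetric])

lemma cst_add: "cst q z \<boxplus> cst q w = cst q (z + w)"
proof -
  have "fmon z [] \<oplus>\<^bsub>free_alg\<^esub> fmon w [] = fmon (z + w) []" by (auto simp: free_add fmon_apply)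
  then show ?thesis unfolding cst_def by (simp flip: cls.hom_add)
qed

lemma cst_mult: "cst q z \<boxdot> cst q w = cst q (z * w)"
  unfolding cst_def by (simp add: fmon_mult flip: cls.hom_mult)

lemma cst_mult_assoc: "x \<in> S \<Longrightarrow> cst q z \<boxdot> (cst q w \<boxdot> x) = cst q (z * w) \<boxdot> x"
  by (simp add: cst_mult flip: S.m_assoc)

lemma cst_minus: "\<ominus>\<^bsub>su2 q\<^esub> cst q z = cst q (- z)"
  by (rule S.minus_equality) (simp_all add: cst_add)

lemma cst_eq_iff: "cst q z = cst q w \<longleftrightarrow> z = w"
proof
  assume "cst q z = cst q w"
  then have "cst q (z - w) = cst q 0"
    using cst_add[of z "- w"] cst_add[of w "- w"] by simp
  then show "z = w" by (simp add: cst_eq_zero_iff)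
qed simp

lemma cst_central: "x \<in> S \<Longrightarrow> x \<boxdot> cst q z = cst q z \<boxdot> x"
  by (erule cls_surj)
    (simp add: cst_def free_one_mult free_mult_one flip: cls.hom_mult)

lemma cst_left_commute:
  assumes "x \<in> S" "y \<in> S"
  shows "x \<boxdot> (cst q z \<boxdot> y) = cst q z \<boxdot> (x \<boxdot> y)"
  using assms by (simp add: cst_central flip: S.m_assoc)

lemma cst_add_distrib: "x \<in> S \<Longrightarrow> cst q z \<boxdot> x \<boxplus> cst q w \<boxdot> x = cst q (z + w) \<boxdot> x"
  by (simp add: S.l_distr flip: cst_add)

lemma cls_fmon: "cls q (fmon z w) = cst q z \<boxdot> cls q (fmon 1 w)"
  by (simp add: cst_def fmon_mult flip: cls.hom_mult)

lemma gen_closed [simp]: "gen q x \<in> S"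
  by (simp add: gen_def)

lemma cls_fmon_Cons: "cls q (fmon 1 (x # w)) = gen q x \<boxdot> cls q (fmon 1 w)"
  by (simp add: gen_def fmon_mult flip: cls.hom_mult)

text \<open>For identities stable under sums and products, such as \<open>twist_E0\<close> and
  \<open>d_twist\<close>: they then need checking on generators only.\<close>

lemma su2_induct [consumes 1, case_names cst gen add mult]:
  assumes "x \<in> S"
    and cst: "\<And>z. P (cst q z)"
    and gen: "\<And>x. P (gen q x)"
    and add: "\<And>x y. \<lbrakk>x \<in> S; y \<in> S; P x; P y\<rbrakk> \<Longrightarrow> P (x \<boxplus> y)"
    and mult: "\<And>x y. \<lbrakk>x \<in> S; y \<in> S; P x; P y\<rbrakk> \<Longrightarrow> P (x \<boxdot> y)"
  shows "P x"
proof -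
  have word: "P (cls q (fmon 1 w))" for w
  proof (induction w)
    case Nil
    then show ?case using cst[of 1] by (simp add: cst_def)
  next
    case (Cons x w)
    then show ?case using mult[OF gen_closed _ gen] by (simp add: cls_fmon_Cons[of x w])
  qed
  obtain f where f: "f \<in> carrier free_alg" "x = cls q f"
    using assms(1) by (rule cls_surj)
  from f(1) have "P (cls q f)"
  proof (induction f rule: free_induct)
    case zero
    then show ?case using cst[of 0] by simp
  next
    case (add z w f)
    then show ?case
      using assms(4)[OF _ _ mult[OF _ _ cst[of z] word[of w]] add(2)]
      by (simp add: cls_fmon[of z w, symmetric])
  qed
  then show ?thesis by (simp add: f(2))
qed

subsection \<open>Linear extensions and maps out of the quotient\<close>

definition additive_map :: "((gen list \<Rightarrow> complex) \<Rightarrow> alg) \<Rightarrow> bool" where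
  "additive_map L \<longleftrightarrow>
    (\<forall>f\<in>carrier free_alg. L f \<in> S) \<and>
    (\<forall>f\<in>carrier free_alg. \<forall>g\<in>carrier free_alg. L (f \<oplus>\<^bsub>free_alg\<^esub> g) = L f \<boxplus> L g)"

lemma additive_mapI:
  assumes "\<And>f. f \<in> carrier free_alg \<Longrightarrow> L f \<in> S"
    and "\<And>f g. \<lbrakk>f \<in> carrier free_alg; g \<in> carrier free_alg\<rbrakk> \<Longrightarrow> L (f \<oplus>\<^bsub>free_alg\<^esub> g) = L f \<boxplus> L g"
  shows "additive_map L"
  using assms by (simp add: additive_map_def)

lemma additive_map_closed: "additive_map L \<Longrightarrow> f \<in> carrier free_alg \<Longrightarrow> L f \<in> S"
  by (simp add: additive_map_def)

lemma additive_map_add: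
  "\<lbrakk>additive_map L; f \<in> carrier free_alg; g \<in> carrier free_alg\<rbrakk> \<Longrightarrow> L (f \<oplus>\<^bsub>free_alg\<^esub> g) = L f \<boxplus> L g"
  by (simp add: additive_map_def)

lemma additive_map_zero:
  assumes "additive_map L"
  shows "L \<zero>\<^bsub>free_alg\<^esub> = zer"
proof -
  have "L \<zero>\<^bsub>free_alg\<^esub> \<boxplus> L \<zero>\<^bsub>free_alg\<^esub> = L \<zero>\<^bsub>free_alg\<^esub>"
    using additive_map_add[OF assms F.zero_closed F.zero_closed] by simp
  then show ?thesis
    using additive_map_closed[OF assms F.zero_closed] S.add.l_cancel_one by blast
qed

lemma additive_map_minus:
  assumes "additive_map L" "f \<in> carrier free_alg"
  shows "L (\<ominus>\<^bsub>free_alg\<^esub> f) = \<ominus>\<^bsub>su2 q\<^esub> L f"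
proof -
  have "L (\<ominus>\<^bsub>free_alg\<^esub> f) \<boxplus> L f = zer"
    using assms by (simp add: F.l_neg additive_map_zero flip: additive_map_add[OF assms(1)])
  then show ?thesis
    using assms by (metis S.minus_equality F.a_inv_closed additive_map_closed)
qed

lemma additive_map_comp:
  assumes "additive_map L"
    and "\<And>f. f \<in> carrier free_alg \<Longrightarrow> h f \<in> carrier free_alg"
    and "\<And>f g. \<lbrakk>f \<in> carrier free_alg; g \<in> carrier free_alg\<rbrakk>
      \<Longrightarrow> h (f \<oplus>\<^bsub>free_alg\<^esub> g) = h f \<oplus>\<^bsub>free_alg\<^esub> h g"
  shows "additive_map (\<lambda>f. L (h f))"
  using assms by (simp add: additive_map_def)

text \<open>The ideal used is the kernel of \<open>L\<close> inside \<open>relI\<close>, not the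
  whole kernel: a Leibniz rule for \<open>L (f g)\<close> contains the class of \<open>f\<close>
  times the derivative of \<open>g\<close>, which disappears only for \<open>f\<close> in
  \<open>relI\<close>.\<close>

lemma additive_map_vanishes:
  assumes L: "additive_map L"
    and "\<And>f g. \<lbrakk>f \<in> relI; g \<in> carrier free_alg; L f = zer\<rbrakk>
      \<Longrightarrow> L (f \<otimes>\<^bsub>free_alg\<^esub> g) = zer \<and> L (g \<otimes>\<^bsub>free_alg\<^esub> f) = zer"
    and "\<And>r. r \<in> rels q \<Longrightarrow> L r = zer"
    and "f \<in> relI"
  shows "L f = zer"
proof -
  interpret I: ideal relI free_alg by (rule ideal_relI)
  let ?J = "{f \<in> relI. L f = zer}"
  have "subgroup ?J (add_monoid free_alg)"
    by (intro F.add.subgroupI)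
      (auto simp: a_inv_def[symmetric] additive_map_minus[OF L] additive_map_add[OF L]
        intro!: exI[of _ "\<zero>\<^bsub>free_alg\<^esub>"] additive_map_zero[OF L] dest: I.a_subset[THEN subsetD])
  then have "ideal ?J free_alg"
    by (intro idealI ring_free) (use assms(2) in \<open>auto intro: I.I_l_closed I.I_r_closed\<close>)
  moreover have "rels q \<subseteq> ?J"
    using assms(3) F.genideal_self[OF rels_closed] by auto
  ultimately show ?thesis
    using F.genideal_minimal assms(4) by blast
qed

text \<open>A map that vanishes on \<open>relI\<close> is constant on each coset, so the image is a
  singleton and \<open>the_elem\<close> returns the value at any representative.\<close>

lemma the_elem_image_cls:
  assumes L: "additive_map L"
    and van: "\<And>h. h \<in> relI \<Longrightarrow> L h = zer"
    and f: "f \<in> carrier free_alg"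
  shows "the_elem (L ` cls q f) = L f"
proof -
  interpret I: ideal relI free_alg by (rule ideal_relI)
  have "L (h \<oplus>\<^bsub>free_alg\<^esub> f) = L f" if "h \<in> relI" for h
    using that f by (simp add: van additive_map_add[OF L] additive_map_closed[OF L])
  moreover have "cls q f = {h \<oplus>\<^bsub>free_alg\<^esub> f | h. h \<in> relI}"
    by (auto simp: cls_def a_r_coset_def')
  ultimately have "L ` cls q f = (\<lambda>h. L f) ` relI"
    by (simp add: Setcompr_eq_image image_image)
  then show ?thesis
    using I.zero_closed by (simp add: image_constant)
qed

lemma lin_ext_superset:
  assumes "finite B" "{w. f w \<noteq> 0} \<subseteq> B" "\<And>w. \<phi> w \<in> S"
  shows "lin_ext q \<phi> f = (\<Oplus>\<^bsub>su2 q\<^esub>w\<in>B. cst q (f w) \<boxdot> \<phi> w)"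
  unfolding lin_ext_def
  by (rule S.add.finprod_mono_neutral_cong_left) (use assms in auto)

lemma lin_ext_closed: "(\<And>w. \<phi> w \<in> S) \<Longrightarrow> lin_ext q \<phi> f \<in> S"
  unfolding lin_ext_def by (rule S.finsum_closed) auto

lemma lin_ext_add:
  assumes "\<And>w. \<phi> w \<in> S" "f \<in> carrier free_alg" "g \<in> carrier free_alg"
  shows "lin_ext q \<phi> (f \<oplus>\<^bsub>free_alg\<^esub> g) = lin_ext q \<phi> f \<boxplus> lin_ext q \<phi> g"
proof -
  let ?B = "{w. f w \<noteq> 0} \<union> {w. g w \<noteq> 0}"
  have B: "finite ?B" using assms by (auto simp: free_carrier)
  have "lin_ext q \<phi> (f \<oplus>\<^bsub>free_alg\<^esub> g) =
      (\<Oplus>\<^bsub>su2 q\<^esub>w\<in>?B. cst q (f w) \<boxdot> \<phi> w \<boxplus> cst q (g w) \<boxdot> \<phi> w)"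
    by (subst lin_ext_superset[OF B])
      (auto simp: free_add assms(1) cst_add_distrib intro!: S.finsum_cong)
  also have "\<dots> = lin_ext q \<phi> f \<boxplus> lin_ext q \<phi> g"
    by (subst (1 2) lin_ext_superset[OF B]) (auto simp: assms(1) intro!: S.finsum_addf)
  finally show ?thesis .
qed

lemma lin_ext_fmon:
  assumes "\<And>w. \<phi> w \<in> S"
  shows "lin_ext q \<phi> (fmon z w) = cst q z \<boxdot> \<phi> w"
  using assms by (subst lin_ext_superset[of "{w}"]) (auto simp: fmon_apply)

lemma lin_ext_zero: "lin_ext q \<phi> \<zero>\<^bsub>free_alg\<^esub> = zer"
  by (simp add: lin_ext_def free_zero)

lemma additive_lin_ext: "(\<And>w. \<phi> w \<in> S) \<Longrightarrow> additive_map (lin_ext q \<phi>)"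
  by (intro additive_mapI lin_ext_closed lin_ext_add)

lemma cst_cls_fmon: "cst q z \<boxdot> cls q (fmon z' w) = cls q (fmon (z * z') w)"
  by (simp add: cst_def fmon_mult flip: cls.hom_mult)

lemma cls_fmon_mult: "cls q (fmon z v) \<boxdot> cls q (fmon z' w) = cls q (fmon (z * z') (v @ w))"
  by (simp add: fmon_mult flip: cls.hom_mult)

lemma one_cls: "\<one>\<^bsub>su2 q\<^esub> = cls q (fmon 1 [])"
  by (simp add: free_one[symmetric])

lemma cls_eq_zeroI: "(\<And>w. f w = 0) \<Longrightarrow> cls q f = zer"
  using cls.hom_zero by (simp add: free_zero[unfolded fun_eq_iff] ext[of f "\<zero>\<^bsub>free_alg\<^esub>"] free_zero)

lemma cls_rel: "r \<in> rels q \<Longrightarrow> cls q r = zer"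
  using F.genideal_self[OF rels_closed] rels_closed by (subst cls_eq_zero_iff) auto

text \<open>Here \<open>z\<close> is the coefficient of the word to be rewritten, hence the multiple
  of the relation that is removed.\<close>

lemma cls_eqI:
  assumes "comb cs \<in> rels q" "\<And>w. f w = z * comb cs w + g w" "g \<in> carrier free_alg"
  shows "cls q f = cls q g"
proof -
  have "f = fmon z [] \<otimes>\<^bsub>free_alg\<^esub> comb cs \<oplus>\<^bsub>free_alg\<^esub> g"
    using assms(2) by (auto simp: free_one_mult free_add)
  then show ?thesis using assms by (simp add: cls_rel)
qed

text \<open>The relations oriented as rewrite rules: letters are sorted as a, b, c, d, and ad, da
  become 1 plus a multiple of bc. Words of length two suffice, because derivation and star do not
  lengthen the words of the quadratic relations.\<close>

lemma normal_order:
  "cls q (fmon z [Gb, Ga]) = cls q (fmon (z * q) [Ga, Gb])"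
  "cls q (fmon z [Gc, Ga]) = cls q (fmon (z * q) [Ga, Gc])"
  "cls q (fmon z [Gd, Gb]) = cls q (fmon (z * q) [Gb, Gd])"
  "cls q (fmon z [Gd, Gc]) = cls q (fmon (z * q) [Gc, Gd])"
  "cls q (fmon z [Gc, Gb]) = cls q (fmon z [Gb, Gc])"
  "cls q (fmon z [Ga, Gd]) = cls q (fmon z []) \<boxplus> cls q (fmon (z / q) [Gb, Gc])"
  "cls q (fmon z [Gd, Ga]) = cls q (fmon z []) \<boxplus> cls q (fmon (z * q) [Gb, Gc])"
proof -
  show "cls q (fmon z [Gb, Ga]) = cls q (fmon (z * q) [Ga, Gb])"
    by (rule cls_eqI[where z = z and cs = "[(1, [Gb, Ga]), (-q, [Ga, Gb])]"])
      (auto simp: rels_def comb_def algebra_simps)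
  show "cls q (fmon z [Gc, Ga]) = cls q (fmon (z * q) [Ga, Gc])"
    by (rule cls_eqI[where z = z and cs = "[(1, [Gc, Ga]), (-q, [Ga, Gc])]"])
      (auto simp: rels_def comb_def algebra_simps)
  show "cls q (fmon z [Gd, Gb]) = cls q (fmon (z * q) [Gb, Gd])"
    by (rule cls_eqI[where z = z and cs = "[(1, [Gd, Gb]), (-q, [Gb, Gd])]"])
      (auto simp: rels_def comb_def algebra_simps)
  show "cls q (fmon z [Gd, Gc]) = cls q (fmon (z * q) [Gc, Gd])"
    by (rule cls_eqI[where z = z and cs = "[(1, [Gd, Gc]), (-q, [Gc, Gd])]"])
      (auto simp: rels_def comb_def algebra_simps)
  show "cls q (fmon z [Gc, Gb]) = cls q (fmon z [Gb, Gc])"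
    by (rule cls_eqI[where z = z and cs = "[(1, [Gc, Gb]), (-1, [Gb, Gc])]"])
      (auto simp: rels_def comb_def algebra_simps)
  have ad: "cls q (fmon z [Ga, Gd]) = cls q (comb [(z, []), (z / q, [Gb, Gc])])" for z
    by (rule cls_eqI[where z = z and cs = "[(1, [Ga, Gd]), (-(1 / q), [Gb, Gc]), (-1, [])]"])
      (auto simp: rels_def comb_def algebra_simps)
  then show "cls q (fmon z [Ga, Gd]) = cls q (fmon z []) \<boxplus> cls q (fmon (z / q) [Gb, Gc])"
    by (simp add: comb_Cons_add[of _ _ "[_]"])
  have "cls q (fmon z [Gd, Ga]) = cls q (comb [(z, [Ga, Gd]), (z * (q * (1 - 1 / q\<^sup>2)), [Gb, Gc])])"
    by (rule cls_eqI[where z = z and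
          cs = "[(1, [Gd, Ga]), (-1, [Ga, Gd]), (-(q * (1 - 1 / q\<^sup>2)), [Gb, Gc])]"])
      (auto simp: rels_def comb_def algebra_simps)
  also have "\<dots> = cls q (comb [(z, []), (z / q, [Gb, Gc])]) \<boxplus>
      cls q (fmon (z * (q * (1 - 1 / q\<^sup>2))) [Gb, Gc])"
    by (simp add: comb_Cons_add[of _ _ "[_]"] ad)
  \<comment> \<open>The two multiples of bc add up: 1/q + q (1 - 1/q^2) = q.\<close>
  also have "\<dots> = cls q (comb [(z, []), (z * q, [Gb, Gc])])"
    using q_nz by (auto simp: comb_def free_add field_simps power2_eq_square
        simp flip: cls.hom_add intro!: arg_cong[of _ _ "cls q"])
  finally show "cls q (fmon z [Gd, Ga]) = cls q (fmon z []) \<boxplus> cls q (fmon (z * q) [Gb, Gc])"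
    by (simp add: comb_Cons_add[of _ _ "[_]"])
qed

lemmas word_calculus = cst_cls_fmon cls_fmon_mult one_cls gen_def cgen_def normal_order

lemma additive_map_comb:
  assumes "additive_map L"
  shows "L (comb ((z, v) # cs)) = L (fmon z v) \<boxplus> L (comb cs)"
  unfolding comb_Cons_add[of z v cs] using assms by (simp add: additive_map_add)

subsection \<open>The twisting automorphisms\<close>

definition word_weight :: "idx \<Rightarrow> gen list \<Rightarrow> complex" where
  "word_weight i w = prod_list (map (bim q i) w)"

text \<open>The lift of the twist to the free algebra. It is diagonal in the words, with
  multiplicative eigenvalues, so multiplicativity and commutation of the twists are
  immediate.\<close>

definition scale :: "idx \<Rightarrow> (gen list \<Rightarrow> complex) \<Rightarrow> gen list \<Rightarrow> complex" where
  "scale i f = (\<lambda>w. word_weight i w * f w)"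

lemma word_weight_append: "word_weight i (v @ w) = word_weight i v * word_weight i w"
  by (simp add: word_weight_def)

lemma scale_closed [simp]: "f \<in> carrier free_alg \<Longrightarrow> scale i f \<in> carrier free_alg"
  unfolding free_carrier scale_def by (rule finite_subset[of _ "{w. f w \<noteq> 0}"]) auto

lemma scale_add: "scale i (f \<oplus>\<^bsub>free_alg\<^esub> g) = scale i f \<oplus>\<^bsub>free_alg\<^esub> scale i g"
  by (simp add: scale_def free_add distrib_left)

lemma scale_zero: "scale i \<zero>\<^bsub>free_alg\<^esub> = \<zero>\<^bsub>free_alg\<^esub>"
  by (simp add: scale_def free_zero)

lemma scale_fmon: "scale i (fmon z w) = fmon (word_weight i w * z) w"
  by (auto simp: scale_def fmon_apply)

lemma scale_mult: "scale i (f \<otimes>\<^bsub>free_alg\<^esub> g) = scale i f \<otimes>\<^bsub>free_alg\<^esub> scale i g"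
proof
  fix w :: "gen list"
  have "word_weight i w = word_weight i (take k w) * word_weight i (drop k w)" for k
    by (simp flip: word_weight_append)
  then show "scale i (f \<otimes>\<^bsub>free_alg\<^esub> g) w = (scale i f \<otimes>\<^bsub>free_alg\<^esub> scale i g) w"
    unfolding scale_def free_mult sum_distrib_left
    by (intro sum.cong refl) (metis mult.assoc mult.left_commute)
qed

lemma scale_commute: "scale i (scale j f) = scale j (scale i f)"
  by (simp add: scale_def mult.left_commute)

lemma twist_word_eq: "twist_word q i w = cls q (fmon (word_weight i w) w)"
proof (induction w)
  case (Cons x w)
  then show ?case by (simp add: cgen_def gen_def cst_cls_fmon cls_fmon_mult word_weight_def)
qed (simp add: one_cls word_weight_def)

lemma additive_cls: "additive_map (cls q)"
  by (rule additive_mapI) simp_all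

lemma additive_cls_scale: "additive_map (\<lambda>f. cls q (scale i f))"
  by (rule additive_map_comp[OF additive_cls]) (simp_all add: scale_add)

lemma lin_ext_twist_word:
  assumes "f \<in> carrier free_alg"
  shows "lin_ext q (twist_word q i) f = cls q (scale i f)"
  using assms
proof (induction f rule: free_induct)
  case zero
  then show ?case by (simp add: lin_ext_zero scale_zero)
next
  case (add z w f)
  then show ?case
    by (simp add: lin_ext_add lin_ext_fmon twist_word_eq scale_add scale_fmon cst_cls_fmon
        mult.commute)
qed

text \<open>The relations before \<open>comb\<close> is applied: weights and termwise evaluation
  refer to the listed words, which the functions in \<open>rels\<close> no longer display.\<close>

definition rel_lists :: "(complex \<times> gen list) list set" where
  "rel_lists =
    {[(1, [Gb, Ga]), (-q, [Ga, Gb])],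
     [(1, [Gc, Ga]), (-q, [Ga, Gc])],
     [(1, [Gd, Gb]), (-q, [Gb, Gd])],
     [(1, [Gd, Gc]), (-q, [Gc, Gd])],
     [(1, [Gc, Gb]), (-1, [Gb, Gc])],
     [(1, [Gd, Ga]), (-1, [Ga, Gd]), (-(q * (1 - 1 / q\<^sup>2)), [Gb, Gc])],
     [(1, [Ga, Gd]), (-(1 / q), [Gb, Gc]), (-1, [])]}"

lemma rels_eq: "rels q = comb ` rel_lists"
  by (simp add: rels_def rel_lists_def)

text \<open>Every defining relation is homogeneous for the weights.\<close>

lemma cls_scale_rel:
  assumes "r \<in> rels q"
  shows "cls q (scale i r) = zer"
proof -
  have hom: "cls q (scale i (comb cs)) = zer"
    if "comb cs \<in> rels q" "\<forall>(z, w)\<in>set cs. word_weight i w = c" for cs c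
  proof -
    have "scale i (comb cs) = fmon c [] \<otimes>\<^bsub>free_alg\<^esub> comb cs"
      using that(2) unfolding free_one_mult scale_def fun_eq_iff
      by (induction cs) (auto simp: comb_def distrib_left)
    then show ?thesis using that(1) by (simp add: cls_rel)
  qed
  obtain cs where cs: "cs \<in> rel_lists" "r = comb cs"
    using assms by (auto simp: rels_eq)
  then have "\<forall>(z, w)\<in>set cs. word_weight i w = word_weight i (snd (hd cs))"
    using q_nz by (auto simp: rel_lists_def word_weight_def)
  then show ?thesis using assms hom cs(2) by blast
qed

lemma cls_scale_vanishes: "f \<in> relI \<Longrightarrow> cls q (scale i f) = zer"
proof (erule additive_map_vanishes[OF additive_cls_scale, rotated 2])
  fix f g assume *: "f \<in> relI" "g \<in> carrier free_alg" "cls q (scale i f) = zer"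
  then have "f \<in> carrier free_alg"
    using ideal.Icarr[OF ideal_relI] by blast
  then show "cls q (scale i (f \<otimes>\<^bsub>free_alg\<^esub> g)) = zer \<and> cls q (scale i (g \<otimes>\<^bsub>free_alg\<^esub> f)) = zer"
    using * by (simp add: scale_mult)
qed (rule cls_scale_rel)

lemma relI_closed: "f \<in> relI \<Longrightarrow> f \<in> carrier free_alg"
  using ideal.Icarr[OF ideal_relI] by blast

lemma cls_subset_carrier: "f \<in> carrier free_alg \<Longrightarrow> cls q f \<subseteq> carrier free_alg"
  by (auto simp: cls_def a_r_coset_def' relI_closed)

lemma twist_cls:
  assumes "f \<in> carrier free_alg"
  shows "twist q i (cls q f) = cls q (scale i f)"
proof -
  have "lin_ext q (twist_word q i) ` cls q f = (\<lambda>f. cls q (scale i f)) ` cls q f"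
    using cls_subset_carrier[OF assms] by (intro image_cong refl lin_ext_twist_word) auto
  then show ?thesis
    unfolding twist_def
    using the_elem_image_cls[OF additive_cls_scale cls_scale_vanishes assms] by simp
qed

lemma twist_closed [simp]: "x \<in> S \<Longrightarrow> twist q i x \<in> S"
  by (erule cls_surj) (simp add: twist_cls)

lemma twist_add [simp]: "x \<in> S \<Longrightarrow> y \<in> S \<Longrightarrow> twist q i (x \<boxplus> y) = twist q i x \<boxplus> twist q i y"
  by (elim cls_surj) (simp add: twist_cls scale_add flip: cls.hom_add)

lemma twist_mult [simp]: "x \<in> S \<Longrightarrow> y \<in> S \<Longrightarrow> twist q i (x \<boxdot> y) = twist q i x \<boxdot> twist q i y"
  by (elim cls_surj) (simp add: twist_cls scale_mult flip: cls.hom_mult)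

lemma twist_cst [simp]: "twist q i (cst q z) = cst q z"
  by (simp add: cst_def twist_cls scale_fmon word_weight_def)

lemma twist_zero [simp]: "twist q i zer = zer"
  using twist_cst[of i 0] by simp

lemma twist_one [simp]: "twist q i \<one>\<^bsub>su2 q\<^esub> = \<one>\<^bsub>su2 q\<^esub>"
  using twist_cst[of i 1] by simp

lemma twist_commute: "x \<in> S \<Longrightarrow> twist q i (twist q j x) = twist q j (twist q i x)"
  by (erule cls_surj) (simp add: twist_cls scale_commute)

lemma twist_fmon: "twist q i (cls q (fmon z w)) = cls q (fmon (word_weight i w * z) w)"
  by (simp add: twist_cls scale_fmon)

lemma twist_gen: "twist q i (gen q x) = cst q (bim q i x) \<boxdot> gen q x"
  by (simp add: gen_def twist_fmon word_weight_def cst_cls_fmon)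

subsection \<open>The derivation\<close>

lemma d_gen_simps:
  "d_gen q Ga E0 = gen q Ga" "d_gen q Ga Ep = cgen q q Gb" "d_gen q Ga Em = zer"
  "d_gen q Gb E0 = cgen q (-(1 / q\<^sup>2)) Gb" "d_gen q Gb Ep = zer" "d_gen q Gb Em = gen q Ga"
  "d_gen q Gc E0 = gen q Gc" "d_gen q Gc Ep = cgen q q Gd" "d_gen q Gc Em = zer"
  "d_gen q Gd E0 = cgen q (-(1 / q\<^sup>2)) Gd" "d_gen q Gd Ep = zer" "d_gen q Gd Em = gen q Gc"
  by (simp_all add: madd_def lmul_def bas_def cgen_def)

lemma d_gen_closed [simp]: "d_gen q x i \<in> S"
  by (cases x; cases i)
    (simp_all only: d_gen_simps cgen_def gen_closed cst_closed S.m_closed S.zero_closed)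

declare d_gen.simps [simp del]

lemma d_word_Nil: "d_word q [] i = zer"
  by (simp add: mzero_def)

lemma d_word_Cons:
  "d_word q (x # w) i = d_gen q x i \<boxdot> cls q (fmon (word_weight i w) w) \<boxplus> gen q x \<boxdot> d_word q w i"
  by (simp add: madd_def rmul_def lmul_def twist_fmon)

declare d_word.simps [simp del]

lemma d_word_closed [simp]: "d_word q w i \<in> S"
  by (induction w) (simp_all add: d_word_Nil d_word_Cons)

text \<open>The Leibniz rule for d, read in one component: moving the right factor \<open>w\<close>
  to the left of e^i multiplies it by its weight.\<close>

lemma d_word_append:
  "d_word q (v @ w) i =
    d_word q v i \<boxdot> cls q (fmon (word_weight i w) w) \<boxplus> cls q (fmon 1 v) \<boxdot> d_word q w i"
proof (induction v)
  case Nil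
  then show ?case by (simp add: d_word_Nil one_cls[symmetric])
next
  case (Cons x v)
  have "cls q (fmon (word_weight i (v @ w)) (v @ w)) =
      cls q (fmon (word_weight i v) v) \<boxdot> cls q (fmon (word_weight i w) w)"
    by (simp add: cls_fmon_mult word_weight_append)
  then show ?case
    by (simp add: d_word_Cons Cons cls_fmon_Cons[of x v] S.l_distr S.r_distr S.m_assoc S.a_assoc)
qed

abbreviation dfree :: "idx \<Rightarrow> (gen list \<Rightarrow> complex) \<Rightarrow> alg" where
  "dfree i \<equiv> lin_ext q (\<lambda>w. d_word q w i)"

lemma additive_dfree: "additive_map (dfree i)"
  by (rule additive_lin_ext) simp

lemma dfree_fmon: "dfree i (fmon z w) = cst q z \<boxdot> d_word q w i"
  by (simp add: lin_ext_fmon)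

lemma dfree_mult:
  assumes "f \<in> carrier free_alg" "g \<in> carrier free_alg"
  shows "dfree i (f \<otimes>\<^bsub>free_alg\<^esub> g) = dfree i f \<boxdot> cls q (scale i g) \<boxplus> cls q f \<boxdot> dfree i g"
  using assms
proof (rule biadditive_free_eq)
  fix z z' v w
  show "dfree i (fmon z v \<otimes>\<^bsub>free_alg\<^esub> fmon z' w) =
      dfree i (fmon z v) \<boxdot> cls q (scale i (fmon z' w)) \<boxplus> cls q (fmon z v) \<boxdot> dfree i (fmon z' w)"
    unfolding cls_fmon[of z v] scale_fmon
      cls_fmon[of "word_weight i w * z'" w] 
    by (simp add: fmon_mult dfree_fmon d_word_append S.r_distr S.m_assoc cst_mult_assoc
        cst_left_commute[of "d_word q v i"] cst_left_commute[of "cls q (fmon 1 v)"]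
        cls_fmon[of "word_weight i w" w] mult_ac)
next
  fix f g h
  assume *: "f \<in> carrier free_alg" "g \<in> carrier free_alg" "h \<in> carrier free_alg"
  note c = additive_map_closed[OF additive_dfree]
  show "dfree i ((f \<oplus>\<^bsub>free_alg\<^esub> g) \<otimes>\<^bsub>free_alg\<^esub> h) =
      dfree i (f \<oplus>\<^bsub>free_alg\<^esub> g) \<boxdot> cls q (scale i h) \<boxplus> cls q (f \<oplus>\<^bsub>free_alg\<^esub> g) \<boxdot> dfree i h"
    if "dfree i (f \<otimes>\<^bsub>free_alg\<^esub> h) = dfree i f \<boxdot> cls q (scale i h) \<boxplus> cls q f \<boxdot> dfree i h"
      "dfree i (g \<otimes>\<^bsub>free_alg\<^esub> h) = dfree i g \<boxdot> cls q (scale i h) \<boxplus> cls q g \<boxdot> dfree i h"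
    using * that by (simp add: F.l_distr additive_map_add[OF additive_dfree] S.l_distr c S.add.m_ac)
  show "dfree i (f \<otimes>\<^bsub>free_alg\<^esub> (g \<oplus>\<^bsub>free_alg\<^esub> h)) =
      dfree i f \<boxdot> cls q (scale i (g \<oplus>\<^bsub>free_alg\<^esub> h)) \<boxplus> cls q f \<boxdot> dfree i (g \<oplus>\<^bsub>free_alg\<^esub> h)"
    if "dfree i (f \<otimes>\<^bsub>free_alg\<^esub> g) = dfree i f \<boxdot> cls q (scale i g) \<boxplus> cls q f \<boxdot> dfree i g"
      "dfree i (f \<otimes>\<^bsub>free_alg\<^esub> h) = dfree i f \<boxdot> cls q (scale i h) \<boxplus> cls q f \<boxdot> dfree i h"
    using * that
    by (simp add: F.r_distr additive_map_add[OF additive_dfree] scale_add S.r_distr c S.add.m_ac)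
qed (simp_all add: lin_ext_zero scale_zero additive_map_closed[OF additive_dfree])

lemma dfree_rel:
  assumes "r \<in> rels q"
  shows "dfree i r = zer"
proof -
  obtain cs where cs: "cs \<in> rel_lists" "r = comb cs"
    using assms by (auto simp: rels_eq)
  have "dfree i (comb cs) = zer"
    \<comment> \<open>Seven relations times three components: after normal ordering each is the
      class of a function all of whose coefficients cancel.\<close>
    using cs(1)[unfolded rel_lists_def, simplified] q_nz
    by - (elim disjE; cases i; simp add: additive_map_comb[OF additive_dfree, of _ _ "_ # _"]
        dfree_fmon d_word_Nil d_word_Cons d_gen_simps word_calculus word_weight_def S.r_distr S.a_assoc
        del: cls.hom_add;
      (simp flip: cls.hom_add)?; rule cls_eq_zeroI; simp add: free_add fmon_apply;
      (simp add: field_simps power2_eq_square)?)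
  then show ?thesis by (simp add: cs(2))
qed

text \<open>The twist has to descend first, since the product rule for \<open>dfree i\<close> of
  \<open>g\<close> times \<open>f\<close> leaves a term with
  \<open>cls q (scale i f)\<close>.\<close>

lemma dfree_vanishes: "f \<in> relI \<Longrightarrow> dfree i f = zer"
proof (erule additive_map_vanishes[OF additive_dfree, rotated 2])
  fix f g assume *: "f \<in> relI" "g \<in> carrier free_alg" "dfree i f = zer"
  then have "f \<in> carrier free_alg" "cls q f = zer"
    using cls_eq_zero_iff by (simp_all add: relI_closed)
  then show "dfree i (f \<otimes>\<^bsub>free_alg\<^esub> g) = zer \<and> dfree i (g \<otimes>\<^bsub>free_alg\<^esub> f) = zer"
    using * by (simp add: dfree_mult cls_scale_vanishes additive_map_closed[OF additive_dfree])
qed (rule dfree_rel)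

lemma d_cls: "f \<in> carrier free_alg \<Longrightarrow> d q (cls q f) i = dfree i f"
  unfolding d_def by (rule the_elem_image_cls[OF additive_dfree dfree_vanishes])

lemma d_closed [simp]: "x \<in> S \<Longrightarrow> d q x i \<in> S"
  by (erule cls_surj) (simp add: d_cls lin_ext_closed)

lemma d_add: "\<lbrakk>x \<in> S; y \<in> S\<rbrakk> \<Longrightarrow> d q (x \<boxplus> y) i = d q x i \<boxplus> d q y i"
  by (elim cls_surj) (simp add: d_cls additive_map_add[OF additive_dfree] flip: cls.hom_add)

lemma d_mult:
  "\<lbrakk>x \<in> S; y \<in> S\<rbrakk> \<Longrightarrow> d q (x \<boxdot> y) i = d q x i \<boxdot> twist q i y \<boxplus> x \<boxdot> d q y i"
  by (elim cls_surj) (simp add: d_cls dfree_mult twist_cls flip: cls.hom_mult)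

lemma d_cst [simp]: "d q (cst q z) i = zer"
  by (simp add: cst_def d_cls dfree_fmon d_word_Nil)

lemma d_zero [simp]: "d q zer i = zer"
  using d_cst[of 0 i] by simp

lemma d_one [simp]: "d q \<one>\<^bsub>su2 q\<^esub> i = zer"
  using d_cst[of 1 i] by simp

lemma d_gen: "d q (gen q x) i = d_gen q x i"
  by (simp add: gen_def d_cls dfree_fmon d_word_Cons d_word_Nil word_weight_def one_cls[symmetric])

lemma d_cst_mult: "x \<in> S \<Longrightarrow> d q (cst q z \<boxdot> x) i = cst q z \<boxdot> d q x i"
  by (simp add: d_mult)

lemma cst_mult_eqI: "z = w \<Longrightarrow> cst q z \<boxdot> x = cst q w \<boxdot> x"
  by simp

lemma add_cst_mult: "x \<in> S \<Longrightarrow> x \<boxplus> cst q z \<boxdot> x = cst q (1 + z) \<boxdot> x"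
  using cst_add_distrib[of x 1 z] by simp

text \<open>On generators, D_0 acts by 1 on a, c and by -1/q^2 on b, d, which matches the twist by
  q^2 and 1/q^2. The right side is multiplicative because D_0 obeys the Leibniz rule twisted by
  t_0.\<close>

lemma twist_E0: "x \<in> S \<Longrightarrow> twist q E0 x = x \<boxplus> cst q (q\<^sup>2 - 1) \<boxdot> d q x E0"
proof (induction x rule: su2_induct)
  case (gen x)
  show ?case
    using q_nz
    by (cases x; simp add: d_gen twist_gen d_gen_simps cgen_def cst_mult_assoc add_cst_mult)
      (rule cst_mult_eqI; simp add: field_simps)+
next
  case (add x y)
  then show ?case by (simp add: d_add S.r_distr S.add.m_ac)
next
  case (mult x y)
  then show ?case
    by (simp add: d_mult S.l_distr S.r_distr S.m_assoc cst_left_commute[of x] S.add.m_ac)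
qed simp

text \<open>The twist t_i multiplies a, c by \<open>bim q i Ga\<close> and b, d by its inverse. D_+
  sends a, c to multiples of b, d, and D_- goes the other way, so commuting with t_i costs the
  square of this number or its inverse; D_0 preserves the weight.\<close>

definition d_weight :: "idx \<Rightarrow> idx \<Rightarrow> complex" where
  "d_weight i k = (case k of
      E0 \<Rightarrow> 1
    | Ep \<Rightarrow> (bim q i Ga)\<^sup>2
    | Em \<Rightarrow> 1 / (bim q i Ga)\<^sup>2)"

lemma d_twist: "x \<in> S \<Longrightarrow> d q (twist q i x) k = cst q (d_weight i k) \<boxdot> twist q i (d q x k)"
proof (induction x rule: su2_induct)
  case (gen x)
  show ?case
    using q_nz
    by (cases x; cases k; simp add: d_gen twist_gen d_gen_simps cgen_def d_cst_mult cst_mult_assoc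
        cst_mult d_weight_def)
      (intro conjI impI; rule cst_mult_eqI; simp add: field_simps eval_nat_numeral)+
next
  case (add x y)
  then show ?case by (simp add: d_add S.r_distr)
next
  case (mult x y)
  then show ?case
    by (simp add: d_mult S.r_distr S.m_assoc cst_left_commute[of "twist q i x"]
        twist_commute[of y i k])
qed simp

subsection \<open>The star\<close>

lemma star_gen_simps:
  "star_gen q Ga = cls q (fmon 1 [Gd])" "star_gen q Gb = cls q (fmon (-(1 / q)) [Gc])"
  "star_gen q Gc = cls q (fmon (-q) [Gb])" "star_gen q Gd = cls q (fmon 1 [Ga])"
  by (simp_all add: cgen_def gen_def cst_cls_fmon)

lemma star_gen_closed [simp]: "star_gen q x \<in> S"
  by (cases x) (simp_all only: star_gen_simps cls.hom_closed comb_closed)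

declare star_gen.simps [simp del]

lemma star_word_closed [simp]: "star_word q w \<in> S"
  by (induction w) simp_all

lemma star_word_append: "star_word q (v @ w) = star_word q w \<boxdot> star_word q v"
  by (induction v) (simp_all add: S.m_assoc)

text \<open>\<open>lin_ext\<close> is linear, so antilinearity is obtained by conjugating the
  coefficients beforehand.\<close>

definition starfree :: "(gen list \<Rightarrow> complex) \<Rightarrow> alg" where
  "starfree f = lin_ext q (star_word q) (\<lambda>w. cnj (f w))"

lemma additive_starfree: "additive_map starfree"
  unfolding starfree_def
  by (rule additive_map_comp[OF additive_lin_ext]) (simp_all add: free_carrier free_add)

lemma starfree_fmon: "starfree (fmon z w) = cst q (cnj z) \<boxdot> star_word q w"
proof -
  have "(\<lambda>v. cnj (fmon z w v)) = fmon (cnj z) w" by (auto simp: fmon_apply)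
  then show ?thesis by (simp add: starfree_def lin_ext_fmon)
qed

lemma starfree_zero: "starfree \<zero>\<^bsub>free_alg\<^esub> = zer"
  by (rule additive_map_zero[OF additive_starfree])

lemma starfree_mult:
  assumes "f \<in> carrier free_alg" "g \<in> carrier free_alg"
  shows "starfree (f \<otimes>\<^bsub>free_alg\<^esub> g) = starfree g \<boxdot> starfree f"
  using assms
proof (rule biadditive_free_eq)
  fix z z' v w
  show "starfree (fmon z v \<otimes>\<^bsub>free_alg\<^esub> fmon z' w) = starfree (fmon z' w) \<boxdot> starfree (fmon z v)"
    by (simp add: fmon_mult starfree_fmon star_word_append S.m_assoc cst_mult_assoc
        cst_left_commute[of "star_word q w"] mult.commute)
qed (simp_all add: starfree_zero additive_map_add[OF additive_starfree] F.l_distr F.r_distr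
    S.l_distr S.r_distr additive_map_closed[OF additive_starfree])

lemma starfree_rel:
  assumes "r \<in> rels q"
  shows "starfree r = zer"
proof -
  obtain cs where cs: "cs \<in> rel_lists" "r = comb cs"
    using assms by (auto simp: rels_eq)
  have "starfree (comb cs) = zer"
    using cs(1)[unfolded rel_lists_def, simplified] q_nz
    by - (elim disjE; simp add: additive_map_comb[OF additive_starfree, of _ _ "_ # _"]
        starfree_fmon star_gen_simps word_calculus S.r_distr S.a_assoc del: cls.hom_add;
      (simp flip: cls.hom_add)?; rule cls_eq_zeroI; simp add: free_add fmon_apply;
      (simp add: field_simps power2_eq_square)?)
  then show ?thesis by (simp add: cs(2))
qed

lemma starfree_vanishes: "f \<in> relI \<Longrightarrow> starfree f = zer"
  by (erule additive_map_vanishes[OF additive_starfree, rotated 2])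
    (simp_all add: starfree_mult relI_closed starfree_rel additive_map_closed[OF additive_starfree])

lemma star_cls: "f \<in> carrier free_alg \<Longrightarrow> star q (cls q f) = starfree f"
  unfolding star_def
  using the_elem_image_cls[OF additive_starfree starfree_vanishes]
  by (simp add: starfree_def[abs_def])

lemma star_closed [simp]: "x \<in> S \<Longrightarrow> star q x \<in> S"
  by (erule cls_surj) (simp add: star_cls additive_map_closed[OF additive_starfree])

lemma star_mult: "\<lbrakk>x \<in> S; y \<in> S\<rbrakk> \<Longrightarrow> star q (x \<boxdot> y) = star q y \<boxdot> star q x"
  by (elim cls_surj) (simp add: star_cls starfree_mult flip: cls.hom_mult)

lemma star_cst [simp]: "star q (cst q z) = cst q (cnj z)"
  by (simp add: cst_def star_cls starfree_fmon cls_fmon_mult one_cls)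

lemma star_zero [simp]: "star q zer = zer"
  using star_cst[of 0] by simp

lemma star_one [simp]: "star q \<one>\<^bsub>su2 q\<^esub> = \<one>\<^bsub>su2 q\<^esub>"
  using star_cst[of 1] by simp

lemma star_cst_mult: "x \<in> S \<Longrightarrow> star q (cst q z \<boxdot> x) = cst q (cnj z) \<boxdot> star q x"
  by (simp add: star_mult cst_central)

end

instance idx :: finite
proof
  have "(UNIV :: idx set) = {Ep, E0, Em}" using idx.exhaust by blast
  then show "finite (UNIV :: idx set)" by (metis finite.emptyI finite.insertI)
qed

context qsu2
begin

subsection \<open>Free modules\<close>

lemma fmodD: "\<xi> \<in> fmod q \<Longrightarrow> \<xi> i \<in> S"
  by (simp add: fmod_def)

lemma fmodI: "(\<And>i. \<xi> i \<in> S) \<Longrightarrow> \<xi> \<in> fmod q"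
  by (simp add: fmod_def)

lemma madd_closed [simp]: "\<xi> \<in> fmod q \<Longrightarrow> \<eta> \<in> fmod q \<Longrightarrow> madd q \<xi> \<eta> \<in> fmod q"
  by (simp add: fmod_def madd_def)

lemma lmul_closed [simp]: "x \<in> S \<Longrightarrow> \<xi> \<in> fmod q \<Longrightarrow> lmul q x \<xi> \<in> fmod q"
  by (simp add: fmod_def lmul_def)

lemma smul_closed [simp]: "\<xi> \<in> fmod q \<Longrightarrow> smul q z \<xi> \<in> fmod q"
  by (simp add: smul_def)

lemma bas_closed [simp]: "bas q i \<in> fmod q"
  by (simp add: fmod_def bas_def)

lemma tens_closed [simp]: "\<xi> \<in> fmod q \<Longrightarrow> \<eta> \<in> fmod q \<Longrightarrow> tens q \<xi> \<eta> \<in> fmod q"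
  by (simp add: fmod_def tens_def)

lemma rmul_closed [simp]: "\<xi> \<in> fmod q \<Longrightarrow> x \<in> S \<Longrightarrow> rmul q \<xi> x \<in> fmod q"
  by (simp add: fmod_def rmul_def)

lemma rmul2_closed [simp]: "\<omega> \<in> fmod q \<Longrightarrow> x \<in> S \<Longrightarrow> rmul2 q \<omega> x \<in> fmod q"
  by (simp add: fmod_def rmul2_def)

lemma d_fmod [simp]: "x \<in> S \<Longrightarrow> d q x \<in> fmod q"
  by (simp add: fmod_def)

definition cfam :: "('i \<Rightarrow> complex) \<Rightarrow> 'i \<Rightarrow> alg" where
  "cfam f = (\<lambda>i. cst q (f i))"

lemma cfam_closed [simp]: "cfam f \<in> fmod q"
  by (simp add: cfam_def fmod_def)

lemma cfam_eq_iff: "cfam f = cfam g \<longleftrightarrow> (\<forall>i. f i = g i)"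
  by (auto simp: cfam_def fun_eq_iff cst_eq_iff)

lemma madd_cfam: "madd q (cfam f) (cfam g) = cfam (\<lambda>i. f i + g i)"
  by (simp add: madd_def cfam_def cst_add)

lemma smul_cfam: "smul q z (cfam f) = cfam (\<lambda>i. z * f i)"
  by (simp add: smul_def lmul_def cfam_def cst_mult)

lemma mdiff_cfam: "mdiff q (cfam f) (cfam g) = cfam (\<lambda>i. f i - g i)"
  by (simp add: mdiff_def cfam_def a_minus_def cst_minus cst_add)

lemma mzero_cfam: "mzero q = cfam (\<lambda>i. 0)"
  by (simp add: mzero_def cfam_def)

lemma mzero_closed [simp]: "mzero q \<in> fmod q"
  by (simp add: mzero_cfam)

lemma bas_cfam: "bas q i = cfam (\<lambda>j. if j = i then 1 else 0)"
  by (simp add: bas_def cfam_def fun_eq_iff)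

lemma ee_cfam: "ee q i j = cfam (\<lambda>p. if p = (i, j) then 1 else 0)"
  by (auto simp: ee_def tens_def bas_def cfam_def fun_eq_iff)

lemma ee_bas: "ee q i j = bas q (i, j)"
  by (simp add: ee_cfam bas_cfam)

lemma ee_closed [simp]: "ee q i j \<in> fmod q"
  by (simp add: ee_cfam)

lemma finsum_support:
  fixes F :: "'j::finite \<Rightarrow> alg"
  assumes "\<And>j. F j \<in> S" "\<And>j. j \<notin> A \<Longrightarrow> F j = zer"
  shows "finsum (su2 q) F UNIV = finsum (su2 q) F A"
  by (rule S.add.finprod_mono_neutral_cong_right) (use assms in auto)

text \<open>The structure maps are nearly monomial in the basis: each output component receives at
  most two input components. This lemma and \<open>msum_pair\<close> collapse all the finite
  sums.\<close>

lemma msum_single: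
  fixes F :: "'j::finite \<Rightarrow> 'i \<Rightarrow> alg"
  assumes "\<And>j. F j i \<in> S" "\<And>j. j \<noteq> a \<Longrightarrow> F j i = zer"
  shows "msum q F i = F a i"
  unfolding msum_def using assms by (subst finsum_support[of _ "{a}"]) auto

lemma msum_pair:
  fixes F :: "'j::finite \<Rightarrow> 'i \<Rightarrow> alg"
  assumes "\<And>j. F j i \<in> S" "\<And>j. j \<noteq> a \<Longrightarrow> j \<noteq> b \<Longrightarrow> F j i = zer" "a \<noteq> b"
  shows "msum q F i = F a i \<boxplus> F b i"
  unfolding msum_def using assms by (subst finsum_support[of _ "{a, b}"]) auto

text \<open>Only additivity is assumed, so that the expansion applies to a connection, which is not
  left linear, as well as to a braiding.\<close>

lemma additive_expand:
  fixes T :: "('i::finite \<Rightarrow> alg) \<Rightarrow> 'j \<Rightarrow> alg"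
  assumes T: "\<And>\<xi>. \<xi> \<in> fmod q \<Longrightarrow> T \<xi> \<in> fmod q"
    and add: "\<And>\<xi> \<eta>. \<xi> \<in> fmod q \<Longrightarrow> \<eta> \<in> fmod q \<Longrightarrow> T (madd q \<xi> \<eta>) = madd q (T \<xi>) (T \<eta>)"
    and \<xi>: "\<xi> \<in> fmod q"
  shows "T \<xi> = msum q (\<lambda>i. T (lmul q (\<xi> i) (bas q i)))"
proof -
  have zero: "T (mzero q) = mzero q"
  proof
    fix j
    have c: "T (mzero q) j \<in> S" using fmodD[OF T] by (simp add: mzero_cfam)
    have "madd q (mzero q) (mzero q) = (mzero q :: 'i \<Rightarrow> alg)" by (simp add: mzero_cfam madd_cfam)
    then have "T (mzero q) = madd q (T (mzero q)) (T (mzero q))"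
      using add[of "mzero q" "mzero q"] by simp
    from fun_cong[OF this, of j] have "T (mzero q) j \<boxplus> T (mzero q) j = T (mzero q) j"
      by (simp add: madd_def)
    then show "T (mzero q) j = mzero q j"
      using S.add.l_cancel_one[OF c c] by (simp add: mzero_def)
  qed
  \<comment> \<open>Truncating the family to \<open>A\<close> lets one index be added at a time;
    \<open>A = UNIV\<close> is the claim.\<close>
  have "T (\<lambda>i. if i \<in> A then \<xi> i else zer) j = (\<Oplus>\<^bsub>su2 q\<^esub>i\<in>A. T (lmul q (\<xi> i) (bas q i)) j)" for A j
  proof (induction A rule: finite_induct[OF finite])
    case 1
    then show ?case using zero by (simp add: mzero_def)
  next
    case (2 a A)
    let ?r = "\<lambda>i. if i \<in> A then \<xi> i else zer"
    have r: "?r \<in> fmod q" using fmodD[OF \<xi>] by (auto intro: fmodI)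
    have "(\<lambda>i. if i \<in> insert a A then \<xi> i else zer) = madd q (lmul q (\<xi> a) (bas q a)) ?r"
      using 2 fmodD[OF \<xi>] by (auto simp: madd_def lmul_def bas_def fun_eq_iff)
    then have "T (\<lambda>i. if i \<in> insert a A then \<xi> i else zer) j =
        T (lmul q (\<xi> a) (bas q a)) j \<boxplus> T ?r j"
      using fmodD[OF \<xi>] r by (simp add: add) (simp add: madd_def)
    then show ?case
      using 2 fmodD[OF T] fmodD[OF \<xi>] by (simp add: Pi_def)
  qed
  from this[of UNIV] show ?thesis
    by (simp add: msum_def fun_eq_iff)
qed

lemma wedge_apply:
  assumes "\<omega> \<in> fmod q"
  shows "wedge q \<omega> Epm = \<omega> (Ep, Em) \<boxplus> cst q (-(q\<^sup>2)) \<boxdot> \<omega> (Em, Ep)"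
    "wedge q \<omega> Ep0 = \<omega> (Ep, E0) \<boxplus> cst q (-(q ^ 4)) \<boxdot> \<omega> (E0, Ep)"
    "wedge q \<omega> Em0 = \<omega> (Em, E0) \<boxplus> cst q (-(1 / q ^ 4)) \<boxdot> \<omega> (E0, Em)"
proof -
  have wb: "wedge_bas q (i, j) = cfam (\<lambda>c.
      if (i, j, c) \<in> {(Ep, Em, Epm), (Ep, E0, Ep0), (Em, E0, Em0)} then (1 :: complex)
      else if (i, j, c) = (Em, Ep, Epm) then -(q\<^sup>2)
      else if (i, j, c) = (E0, Ep, Ep0) then -(q ^ 4)
      else if (i, j, c) = (E0, Em, Em0) then -(1 / q ^ 4) else 0)" for i j
    by (cases i; cases j) (auto simp: mzero_cfam bas_cfam smul_cfam cfam_eq_iff)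
  have "msum q (\<lambda>p. lmul q (\<omega> p) (wedge_bas q p)) Epm = \<omega> (Ep, Em) \<boxplus> cst q (-(q\<^sup>2)) \<boxdot> \<omega> (Em, Ep)"
    using assms fmodD[OF assms]
    by (subst msum_pair[of _ _ "(Ep, Em)" "(Em, Ep)"])
      (auto simp: lmul_def wb cfam_def cst_central split: if_splits simp del: wedge_bas.simps)
  moreover have "msum q (\<lambda>p. lmul q (\<omega> p) (wedge_bas q p)) Ep0 =
      \<omega> (Ep, E0) \<boxplus> cst q (-(q ^ 4)) \<boxdot> \<omega> (E0, Ep)"
    using assms fmodD[OF assms]
    by (subst msum_pair[of _ _ "(Ep, E0)" "(E0, Ep)"])
      (auto simp: lmul_def wb cfam_def cst_central split: if_splits simp del: wedge_bas.simps)
  moreover have "msum q (\<lambda>p. lmul q (\<omega> p) (wedge_bas q p)) Em0 =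
      \<omega> (Em, E0) \<boxplus> cst q (-(1 / q ^ 4)) \<boxdot> \<omega> (E0, Em)"
    using assms fmodD[OF assms]
    by (subst msum_pair[of _ _ "(Em, E0)" "(E0, Em)"])
      (auto simp: lmul_def wb cfam_def cst_central split: if_splits simp del: wedge_bas.simps)
  ultimately show
    "wedge q \<omega> Epm = \<omega> (Ep, Em) \<boxplus> cst q (-(q\<^sup>2)) \<boxdot> \<omega> (Em, Ep)"
    "wedge q \<omega> Ep0 = \<omega> (Ep, E0) \<boxplus> cst q (-(q ^ 4)) \<boxdot> \<omega> (E0, Ep)"
    "wedge q \<omega> Em0 = \<omega> (Em, E0) \<boxplus> cst q (-(1 / q ^ 4)) \<boxdot> \<omega> (E0, Em)"
    by (simp_all add: wedge_def lext_def)
qed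

fun conj_idx :: "idx \<Rightarrow> idx" where
  "conj_idx E0 = E0" | "conj_idx Ep = Em" | "conj_idx Em = Ep"

fun star_coeff :: "idx \<Rightarrow> complex" where
  "star_coeff E0 = -1" | "star_coeff Ep = -(1 / q)" | "star_coeff Em = -q"

lemma conj_idx_conj [simp]: "conj_idx (conj_idx i) = i"
  by (cases i) auto

lemma star_bas_cfam: "star_bas q i = cfam (\<lambda>j. if i = conj_idx j then star_coeff i else 0)"
proof -
  have "(i = conj_idx j) = (j = conj_idx i)" for j by auto
  then show ?thesis by (cases i) (simp_all add: bas_cfam smul_cfam cfam_eq_iff)
qed

text \<open>The star of e^i is a multiple of e^(conj i), and the twist arises from moving the
  starred coefficient to the left of the basis form.\<close>

lemma star1_apply:
  assumes "\<xi> \<in> fmod q"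
  shows "star1 q \<xi> k = cst q (star_coeff (conj_idx k)) \<boxdot> twist q k (star q (\<xi> (conj_idx k)))"
  unfolding star1_def using fmodD[OF assms]
  by (subst msum_single[of _ _ "conj_idx k"]) (auto simp: rmul_def star_bas_cfam cfam_def)

lemma star1_bas: "star1 q (bas q i) = star_bas q i"
  by (auto simp: fun_eq_iff star1_apply star_bas_cfam bas_cfam) (auto simp: cfam_def)

lemma star1_lmul_bas:
  "x \<in> S \<Longrightarrow> star1 q (lmul q x (bas q i)) k =
    (if i = conj_idx k then cst q (star_coeff i) \<boxdot> twist q k (star q x) else zer)"
  by (auto simp: star1_apply) (auto simp: lmul_def bas_def)

text \<open>Reversal of the factors together with conjugation makes the source index
  \<open>(conj_idx l, conj_idx k)\<close>; the starred coefficient passes both basis forms, hence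
  two twists.\<close>

lemma tau_apply:
  assumes "\<omega> \<in> fmod q"
  shows "tau q \<omega> (k, l) = cst q (star_coeff (conj_idx k) * star_coeff (conj_idx l)) \<boxdot>
    twist q k (twist q l (star q (\<omega> (conj_idx l, conj_idx k))))"
  unfolding tau_def using fmodD[OF assms]
  by (subst msum_single[of _ _ "(conj_idx l, conj_idx k)"])
    (auto simp: tens_def star1_bas star_bas_cfam star1_lmul_bas cfam_def cst_mult_assoc
      split: if_splits)

subsection \<open>The braiding and connection with given coefficients\<close>

text \<open>\<open>\<sigma> (e\<^sup>i \<otimes> e\<^sup>j) = flip C i j \<cdot> e\<^sup>j \<otimes> e\<^sup>i + stay C i j \<cdot> e\<^sup>i \<otimes> e\<^sup>j\<close>\<close>

fun flip :: "coeffs \<Rightarrow> idx \<Rightarrow> idx \<Rightarrow> complex" where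
  "flip C i Ep = (if i = E0 then q ^ 4 else q\<^sup>2)"
| "flip C i Em = (if i = E0 then 1 / q ^ 4 else 1 / q\<^sup>2)"
| "flip C i E0 = 1 + (1 - q\<^sup>2) * (case i of E0 \<Rightarrow> c_r C | Ep \<Rightarrow> c_np C | Em \<Rightarrow> c_nm C)"

fun stay :: "coeffs \<Rightarrow> idx \<Rightarrow> idx \<Rightarrow> complex" where
  "stay C Ep E0 = (1 - q\<^sup>2) * c_mp C"
| "stay C Em E0 = (1 - q\<^sup>2) * c_mm C"
| "stay C _ _ = 0"

text \<open>Despite the name these are the coefficients of nabla e^i itself, without the minus sign
  that \<open>christ\<close> carries.\<close>

fun christ_coeff :: "coeffs \<Rightarrow> idx \<Rightarrow> idx \<times> idx \<Rightarrow> complex" where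
  "christ_coeff C E0 (E0, E0) = c_r C"
| "christ_coeff C E0 (Ep, Em) = c_nu C"
| "christ_coeff C E0 (Em, Ep) = c_mu C"
| "christ_coeff C Ep (E0, Ep) = c_np C"
| "christ_coeff C Ep (Ep, E0) = c_mp C"
| "christ_coeff C Em (E0, Em) = c_nm C"
| "christ_coeff C Em (Em, E0) = c_mm C"
| "christ_coeff C _ _ = 0"

lemma all_idx: "(\<forall>i. P i) \<longleftrightarrow> P Ep \<and> P E0 \<and> P Em"
  by (metis idx.exhaust)

definition sigma_bas :: "coeffs \<Rightarrow> idx \<Rightarrow> idx \<Rightarrow> idx \<times> idx \<Rightarrow> alg" where
  "sigma_bas C i j =
    cfam (\<lambda>p. (if p = (j, i) then flip C i j else 0) + (if p = (i, j) then stay C i j else 0))"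

lemma has_coeffs_iff:
  "has_coeffs q C nabla \<sigma> \<longleftrightarrow>
    (\<forall>i. nabla (bas q i) = cfam (christ_coeff C i)) \<and> (\<forall>i j. \<sigma> (ee q i j) = sigma_bas C i j)"
proof -
  have n:
    "madd q (smul q (c_r C) (ee q E0 E0))
      (madd q (smul q (c_nu C) (ee q Ep Em)) (smul q (c_mu C) (ee q Em Ep)))
      = cfam (christ_coeff C E0)"
    "madd q (smul q (c_np C) (ee q E0 Ep)) (smul q (c_mp C) (ee q Ep E0)) = cfam (christ_coeff C Ep)"
    "madd q (smul q (c_nm C) (ee q E0 Em)) (smul q (c_mm C) (ee q Em E0)) = cfam (christ_coeff C Em)"
    by (simp_all add: ee_cfam smul_cfam madd_cfam cfam_eq_iff all_idx)
  have s:
    "smul q (1 + c_r C * (1 - q\<^sup>2)) (ee q E0 E0) = sigma_bas C E0 E0"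
    "madd q (smul q (1 + (1 - q\<^sup>2) * c_np C) (ee q E0 Ep)) (smul q ((1 - q\<^sup>2) * c_mp C) (ee q Ep E0))
      = sigma_bas C Ep E0"
    "madd q (smul q (1 + (1 - q\<^sup>2) * c_nm C) (ee q E0 Em)) (smul q ((1 - q\<^sup>2) * c_mm C) (ee q Em E0))
      = sigma_bas C Em E0"
    "smul q (q ^ 4) (ee q Ep E0) = sigma_bas C E0 Ep"
    "smul q (1 / q ^ 4) (ee q Em E0) = sigma_bas C E0 Em"
    "\<And>i. i \<in> {Ep, Em} \<Longrightarrow> smul q (q\<^sup>2) (ee q Ep i) = sigma_bas C i Ep"
    "\<And>i. i \<in> {Ep, Em} \<Longrightarrow> smul q (1 / q\<^sup>2) (ee q Em i) = sigma_bas C i Em"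
    by (auto simp: sigma_bas_def ee_cfam smul_cfam madd_cfam cfam_eq_iff all_idx mult.commute)
  show ?thesis
    unfolding has_coeffs_def n s(1-5) by (simp only: s(6,7) cong: ball_cong) (auto simp: all_idx)
qed

lemma sigma_expand:
  assumes "bimodule_conn q nabla \<sigma>" "\<omega> \<in> fmod q"
  shows "\<sigma> \<omega> = msum q (\<lambda>p. lmul q (\<omega> p) (\<sigma> (bas q p)))"
proof -
  have "\<sigma> \<omega> = msum q (\<lambda>p. \<sigma> (lmul q (\<omega> p) (bas q p)))"
    using assms by (intro additive_expand) (auto simp: bimodule_conn_def PiE_iff)
  also have "\<dots> = msum q (\<lambda>p. lmul q (\<omega> p) (\<sigma> (bas q p)))"
    using assms fmodD[OF assms(2)] by (simp add: bimodule_conn_def)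
  finally show ?thesis .
qed

lemma nabla_expand:
  assumes "bimodule_conn q nabla \<sigma>" "\<xi> \<in> fmod q"
  shows "nabla \<xi> = msum q (\<lambda>i. madd q (tens q (d q (\<xi> i)) (bas q i)) (lmul q (\<xi> i) (nabla (bas q i))))"
proof -
  have "nabla \<xi> = msum q (\<lambda>i. nabla (lmul q (\<xi> i) (bas q i)))"
    using assms by (intro additive_expand) (auto simp: bimodule_conn_def PiE_iff)
  also have "\<dots> = msum q (\<lambda>i. madd q (tens q (d q (\<xi> i)) (bas q i)) (lmul q (\<xi> i) (nabla (bas q i))))"
    using assms fmodD[OF assms(2)] by (simp add: bimodule_conn_def)
  finally show ?thesis .
qed

text \<open>The arguments of \<open>flip\<close> appear transposed because the component at
  \<open>(k, l)\<close> is fed by the flip of e^l (x) e^k.\<close>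

lemma sigma_apply:
  assumes conn: "bimodule_conn q nabla \<sigma>" and C: "has_coeffs q C nabla \<sigma>" and \<omega>: "\<omega> \<in> fmod q"
  shows "\<sigma> \<omega> (k, l) = cst q (flip C l k) \<boxdot> \<omega> (l, k) \<boxplus> cst q (stay C k l) \<boxdot> \<omega> (k, l)"
proof -
  have b: "\<sigma> (bas q (i, j)) = sigma_bas C i j" for i j
    using C by (simp add: has_coeffs_iff ee_bas)
  have [simp]: "\<omega> p \<in> S" for p
    using fmodD[OF \<omega>] .
  show ?thesis
  proof (cases "k = l")
    case True
    \<comment> \<open>On the diagonal the two contributing basis tensors coincide, so a single
      summand remains.\<close>
    have "stay C l l = 0" by (cases l) simp_all
    then show ?thesis
      unfolding sigma_expand[OF conn \<omega>] True
      by (subst msum_single[of _ _ "(l, l)"])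
        (auto simp: lmul_def b sigma_bas_def cfam_def cst_central split: if_splits)
  next
    case False
    then show ?thesis
      unfolding sigma_expand[OF conn \<omega>]
      by (subst msum_pair[of _ _ "(l, k)" "(k, l)"])
        (auto simp: lmul_def b sigma_bas_def cfam_def cst_central split: if_splits)
  qed
qed

text \<open>Left linearity and the left Leibniz rule extend the values on basis elements to
  \<open>fmod q\<close>, and extensionality settles the rest. This is what allows connections to be
  counted by coefficients.\<close>

lemma conn_eqI:
  assumes "bimodule_conn q nabla \<sigma>" "bimodule_conn q nabla' \<sigma>'"
    and "has_coeffs q C nabla \<sigma>" "has_coeffs q C nabla' \<sigma>'"
  shows "nabla = nabla' \<and> \<sigma> = \<sigma>'"
proof
  show "nabla = nabla'"
  proof (rule PiE_ext)
    show "nabla \<in> fmod q \<rightarrow>\<^sub>E fmod q" "nabla' \<in> fmod q \<rightarrow>\<^sub>E fmod q"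
      using assms by (simp_all add: bimodule_conn_def)
    fix \<xi> :: "idx \<Rightarrow> alg" assume \<xi>: "\<xi> \<in> fmod q"
    show "nabla \<xi> = nabla' \<xi>"
      unfolding nabla_expand[OF assms(1) \<xi>] nabla_expand[OF assms(2) \<xi>]
      using assms(3,4) by (simp add: has_coeffs_iff)
  qed
  show "\<sigma> = \<sigma>'"
  proof (rule PiE_ext)
    show "\<sigma> \<in> fmod q \<rightarrow>\<^sub>E fmod q" "\<sigma>' \<in> fmod q \<rightarrow>\<^sub>E fmod q"
      using assms by (simp_all add: bimodule_conn_def)
    fix \<omega> :: "idx \<times> idx \<Rightarrow> alg" assume "\<omega> \<in> fmod q"
    then show "\<sigma> \<omega> = \<sigma>' \<omega>"
      using sigma_apply[OF assms(1,3)] sigma_apply[OF assms(2,4)] by (auto simp: fun_eq_iff)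
  qed
qed

lemma sigma_id_apply:
  assumes conn: "bimodule_conn q nabla \<sigma>" and C: "has_coeffs q C nabla \<sigma>" and \<omega>: "\<omega> \<in> fmod q"
  shows "sigma_id q \<sigma> \<omega> (i, j, k) =
    cst q (flip C j i) \<boxdot> \<omega> (j, i, k) \<boxplus> cst q (stay C i j) \<boxdot> \<omega> (i, j, k)"
proof -
  have b: "\<sigma> (ee q i j) = sigma_bas C i j" for i j
    using C by (simp add: has_coeffs_iff)
  have [simp]: "\<omega> p \<in> S" for p
    using fmodD[OF \<omega>] .
  show ?thesis
  proof (cases "i = j")
    case True
    have "stay C j j = 0" by (cases j) simp_all
    then show ?thesis
      unfolding sigma_id_def lext_def True
      by (subst msum_single[of _ _ "(j, j, k)"])
        (auto simp: lmul_def b sigma_bas_def tens21_def bas_cfam cfam_def cst_central cst_mult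
          split: if_splits)
  next
    case False
    then show ?thesis
      unfolding sigma_id_def lext_def
      by (subst msum_pair[of _ _ "(j, i, k)" "(i, j, k)"])
        (auto simp: lmul_def b sigma_bas_def tens21_def bas_cfam cfam_def cst_central cst_mult
          split: if_splits)
  qed
qed

lemma id_sigma_apply:
  assumes conn: "bimodule_conn q nabla \<sigma>" and C: "has_coeffs q C nabla \<sigma>" and \<omega>: "\<omega> \<in> fmod q"
  shows "id_sigma q \<sigma> \<omega> (i, j, k) =
    cst q (flip C k j) \<boxdot> \<omega> (i, k, j) \<boxplus> cst q (stay C j k) \<boxdot> \<omega> (i, j, k)"
proof -
  have b: "\<sigma> (ee q i j) = sigma_bas C i j" for i j
    using C by (simp add: has_coeffs_iff)
  have [simp]: "\<omega> p \<in> S" for p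
    using fmodD[OF \<omega>] .
  show ?thesis
  proof (cases "j = k")
    case True
    have "stay C k k = 0" by (cases k) simp_all
    then show ?thesis
      unfolding id_sigma_def lext_def True
      by (subst msum_single[of _ _ "(i, k, k)"])
        (auto simp: lmul_def b sigma_bas_def tens12_def bas_cfam cfam_def cst_central cst_mult
          split: if_splits)
  next
    case False
    then show ?thesis
      unfolding id_sigma_def lext_def
      by (subst msum_pair[of _ _ "(i, k, j)" "(i, j, k)"])
        (auto simp: lmul_def b sigma_bas_def tens12_def bas_cfam cfam_def cst_central cst_mult
          split: if_splits)
  qed
qed

lemma sigma_id_closed:
  assumes "bimodule_conn q nabla \<sigma>" "has_coeffs q C nabla \<sigma>" "\<omega> \<in> fmod q"
  shows "sigma_id q \<sigma> \<omega> \<in> fmod q"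
  using fmodD[OF assms(3)] by (auto simp: fmod_def sigma_id_apply[OF assms])

lemma id_sigma_closed:
  assumes "bimodule_conn q nabla \<sigma>" "has_coeffs q C nabla \<sigma>" "\<omega> \<in> fmod q"
  shows "id_sigma q \<sigma> \<omega> \<in> fmod q"
  using fmodD[OF assms(3)] by (auto simp: fmod_def id_sigma_apply[OF assms])

text \<open>All coefficients are constant, so the twists in the star act trivially. A diagonal
  metric leaves j = k in the starred term and j = i in the other; the common minus sign of
  \<open>christ\<close> is dropped.\<close>

lemma preserves_iff:
  assumes "has_coeffs q C nabla \<sigma>"
  shows "preserves q nabla (diag_mat g) \<longleftrightarrow>
    (\<forall>i k c. g k * star_coeff (conj_idx c) * cnj (christ_coeff C k (conj_idx c, i)) +
      g i * christ_coeff C i (c, k) = 0)"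
proof -
  have ch: "christ q nabla i k = cfam (\<lambda>j. - christ_coeff C i (j, k))" for i k
    using assms by (simp add: has_coeffs_iff christ_def cfam_def cst_minus)
  have "msum q (\<lambda>j. madd q (smul q (diag_mat g j k) (star1 q (christ q nabla j i)))
          (smul q (diag_mat g i j) (christ q nabla j k))) c =
      cst q (- (g k * star_coeff (conj_idx c) * cnj (christ_coeff C k (conj_idx c, i)) +
        g i * christ_coeff C i (c, k)))" for i k c
  \<comment> \<open>For i = k both surviving terms sit at the same summation index, otherwise at two
    different ones.\<close>
  proof (cases "i = k")
    case True
    then show ?thesis
      by (subst msum_single[of _ _ k])
        (auto simp: madd_def smul_def lmul_def ch star1_apply diag_mat_def;
          auto simp: cfam_def cst_mult cst_add mult.assoc)+
  next
    case False
    then show ?thesis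
      by (subst msum_pair[of _ _ k i])
        (auto simp: madd_def smul_def lmul_def ch star1_apply diag_mat_def;
          auto simp: cfam_def cst_mult cst_add mult.assoc)+
  qed
  then show ?thesis
    unfolding preserves_def fun_eq_iff mzero_def cst_eq_zero_iff
    by (simp only: cst_eq_zero_iff neg_equal_0_iff_equal)
qed

end

text \<open>Kept outside the locale with \<open>q\<close> explicit, because the limit statement lets
  the parameter vary.\<close>

definition braided_coeffs :: "real \<Rightarrow> complex \<Rightarrow> coeffs" where
  "braided_coeffs q r = \<lparr>c_r = r, c_nu = 0, c_mu = 0,
    c_np = (1 + q\<^sup>2) / q ^ 4, c_nm = -(1 + q\<^sup>2), c_mp = 0, c_mm = 0\<rparr>"

context qsu2
begin

abbreviation sol :: "complex \<Rightarrow> coeffs" where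
  "sol \<equiv> braided_coeffs q"

section \<open>Necessary conditions as equations between complex numbers\<close>

lemma cst_eq_one_iff: "cst q z = \<one>\<^bsub>su2 q\<^esub> \<longleftrightarrow> z = 1"
  using cst_eq_iff[of z 1] by simp

lemma zero_eq_cst_iff: "zer = cst q z \<longleftrightarrow> z = 0"
  using cst_eq_zero_iff[of z] by auto

lemma tau_cfam:
  "tau q (cfam f) =
    cfam (\<lambda>(k, l). star_coeff (conj_idx k) * star_coeff (conj_idx l) *
      cnj (f (conj_idx l, conj_idx k)))"
proof (rule ext, clarify)
  fix k l
  show "tau q (cfam f) (k, l) = cfam (\<lambda>(k, l). star_coeff (conj_idx k) * star_coeff (conj_idx l) *
      cnj (f (conj_idx l, conj_idx k))) (k, l)"
    by (simp add: tau_apply) (simp add: cfam_def cst_mult)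
qed

lemma sigma_cfam:
  assumes "bimodule_conn q nabla \<sigma>" "has_coeffs q C nabla \<sigma>"
  shows "\<sigma> (cfam f) = cfam (\<lambda>(k, l). flip C l k * f (l, k) + stay C k l * f (k, l))"
proof (rule ext, clarify)
  fix k l
  show "\<sigma> (cfam f) (k, l) = cfam (\<lambda>(k, l). flip C l k * f (l, k) + stay C k l * f (k, l)) (k, l)"
    by (simp add: sigma_apply[OF assms]) (simp add: cfam_def cst_mult cst_add)
qed

lemma sigma_id_cfam:
  assumes "bimodule_conn q nabla \<sigma>" "has_coeffs q C nabla \<sigma>"
  shows "sigma_id q \<sigma> (cfam f) =
    cfam (\<lambda>(i, j, k). flip C j i * f (j, i, k) + stay C i j * f (i, j, k))"
proof (rule ext, clarify)
  fix i j k
  show "sigma_id q \<sigma> (cfam f) (i, j, k) =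
      cfam (\<lambda>(i, j, k). flip C j i * f (j, i, k) + stay C i j * f (i, j, k)) (i, j, k)"
    by (simp add: sigma_id_apply[OF assms]) (simp add: cfam_def cst_mult cst_add)
qed

lemma id_sigma_cfam:
  assumes "bimodule_conn q nabla \<sigma>" "has_coeffs q C nabla \<sigma>"
  shows "id_sigma q \<sigma> (cfam f) =
    cfam (\<lambda>(i, j, k). flip C k j * f (i, k, j) + stay C j k * f (i, j, k))"
proof (rule ext, clarify)
  fix i j k
  show "id_sigma q \<sigma> (cfam f) (i, j, k) =
      cfam (\<lambda>(i, j, k). flip C k j * f (i, k, j) + stay C j k * f (i, j, k)) (i, j, k)"
    by (simp add: id_sigma_apply[OF assms]) (simp add: cfam_def cst_mult cst_add)
qed

lemma coeffs_necessary:
  assumes q1: "q\<^sup>2 \<noteq> 1" and g: "\<forall>i. g i \<noteq> 0"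
    and br: "(nabla, \<sigma>) \<in> braided_conns q (diag_mat g)"
    and C: "has_coeffs q C nabla \<sigma>"
  shows "C = sol 0 \<or> C = sol (2 / (q\<^sup>2 - 1))"
proof -
  have conn: "bimodule_conn q nabla \<sigma>" and pres: "preserves q nabla (diag_mat g)"
    and tors: "torsion_compatible q \<sigma>" and star: "star_compatible q \<sigma>"
    and braid: "braid_relation q \<sigma>"
    using br by (simp_all add: braided_conns_def invariant_conn_def)
  have Q0: "complex_of_real q \<noteq> 0" using q_nz by simp
  have Q1: "1 - (complex_of_real q)\<^sup>2 \<noteq> 0"
    using q1 by (metis of_real_1 of_real_eq_iff of_real_power right_minus_eq)
  \<comment> \<open>The coefficients of e^+ wedge e^0 and e^- wedge e^0 after applying wedge (id +
    sigma) to e^+ (x) e^0 and e^- (x) e^0.\<close>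
  have E1: "1 + stay C Ep E0 - q ^ 4 * flip C Ep E0 = 0"
    and E2: "1 + stay C Em E0 - flip C Em E0 / q ^ 4 = 0"
  proof -
    have t: "wedge q (madd q (ee q i E0) (\<sigma> (ee q i E0))) = mzero q" for i
      using tors by (simp add: torsion_compatible_def)
    have "wedge q (madd q (ee q Ep E0) (\<sigma> (ee q Ep E0))) Ep0 = zer"
      unfolding t by (simp add: mzero_def)
    then show "1 + stay C Ep E0 - q ^ 4 * flip C Ep E0 = 0"
      unfolding ee_cfam sigma_cfam[OF conn C] madd_cfam wedge_apply[OF cfam_closed]
      by (simp add: cfam_def cst_mult cst_add cst_eq_zero_iff del: flip.simps stay.simps)
    have "wedge q (madd q (ee q Em E0) (\<sigma> (ee q Em E0))) Em0 = zer"
      unfolding t by (simp add: mzero_def)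
    then show "1 + stay C Em E0 - flip C Em E0 / q ^ 4 = 0"
      unfolding ee_cfam sigma_cfam[OF conn C] madd_cfam wedge_apply[OF cfam_closed]
      by (simp add: cfam_def cst_mult cst_add cst_eq_zero_iff del: flip.simps stay.simps)
  qed
  \<comment> \<open>The star exchanges e^+ and e^-, so the flip of e^- past e^0 is paired with the
    conjugate flip of e^+ past e^0, while the flip of e^0 past itself is paired with its own
    conjugate.\<close>
  have E3: "flip C E0 E0 * cnj (flip C E0 E0) = 1" and E4: "flip C Em E0 * cnj (flip C Ep E0) = 1"
  proof -
    have s: "\<sigma> (tau q (\<sigma> (ee q i j))) (k, l) = tau q (ee q i j) (k, l)" for i j k l
      using star by (simp add: star_compatible_def)
    note s' = s[unfolded ee_cfam sigma_cfam[OF conn C] tau_cfam]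
    show "flip C E0 E0 * cnj (flip C E0 E0) = 1"
      using s'[of E0 E0 E0 E0] by (simp add: cfam_def cst_eq_iff cst_eq_one_iff del: flip.simps)
    show "flip C Em E0 * cnj (flip C Ep E0) = 1"
      using s'[of Ep E0 E0 Em] Q0 by (simp add: cfam_def cst_eq_iff cst_eq_one_iff del: flip.simps)
  qed
  \<comment> \<open>the coefficient of \<open>e\<^sup>- \<otimes> e\<^sup>+ \<otimes> e\<^sup>0\<close> in the braid relation on \<open>e\<^sup>+ \<otimes> e\<^sup>- \<otimes> e\<^sup>0\<close>\<close>
  have E5: "stay C Em E0 * stay C Ep E0 = 0"
  proof -
    let ?u = "cfam (\<lambda>p. if p = (Ep, Em, E0) then 1 else 0)"
    have "sigma_id q \<sigma> (id_sigma q \<sigma> (sigma_id q \<sigma> ?u)) (Em, Ep, E0) =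
        id_sigma q \<sigma> (sigma_id q \<sigma> (id_sigma q \<sigma> ?u)) (Em, Ep, E0)"
      using braid by (simp add: braid_relation_def)
    then show ?thesis
      unfolding sigma_id_cfam[OF conn C] id_sigma_cfam[OF conn C]
      using Q0 by (simp add: cfam_def zero_eq_cst_iff mult_ac del: flip.simps(3) stay.simps(1,2))
  qed
  note P = pres[unfolded preserves_iff[OF C], rule_format]
  have r: "cnj (c_r C) = c_r C"
    using P[of E0 E0 E0] g by simp
  \<comment> \<open>The first index given to \<open>P\<close> is the \<open>k\<close> of
    \<open>preserves_iff\<close>; the other two are equal. The equation thus couples nabla e^0 with
    nabla e^+, and the next one couples nabla e^0 with nabla e^-.\<close>
  have mp: "g Ep * c_mp C = g E0 * q * cnj (c_mu C)"
    using P[of E0 Ep Ep] by (simp add: algebra_simps)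
  have mm: "g Em * c_mm C = g E0 / q * cnj (c_nu C)"
    using P[of E0 Em Em] by (simp add: algebra_simps)
  \<comment> \<open>Whichever stay coefficient vanishes, \<open>E1\<close> or \<open>E2\<close>
    determines the flip belonging to it, and \<open>E4\<close> then determines the other
    flip.\<close>
  have A: "flip C Ep E0 = 1 / q ^ 4 \<and> flip C Em E0 = q ^ 4"
  proof (cases "stay C Em E0 = 0")
    case True
    then have *: "flip C Em E0 = q ^ 4"
      using E2 Q0 by (simp add: field_simps del: flip.simps stay.simps)
    then have "cnj (flip C Ep E0) = cnj (1 / q ^ 4)"
      using E4 Q0 by (simp add: field_simps del: flip.simps)
    then show ?thesis using * by (simp only: complex_cnj_cancel_iff)
  next
    case False
    then have "stay C Ep E0 = 0"
      using E5 by (simp del: stay.simps)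
    then have *: "flip C Ep E0 = 1 / q ^ 4"
      using E1 Q0 by (simp add: field_simps del: flip.simps stay.simps)
    then show ?thesis using E4 Q0 by (simp add: field_simps del: flip.simps)
  qed
  \<comment> \<open>With both flips known, \<open>E1\<close> and \<open>E2\<close> say that both
    stay coefficients are zero; these are 1 - q^2 times \<open>c_mp C\<close> and
    \<open>c_mm C\<close>.\<close>
  have m0: "c_mp C = 0" "c_mm C = 0"
    using E1 E2 A Q0 Q1 by simp_all
  have n0: "c_mu C = 0" "c_nu C = 0"
    using mp mm m0 g q_nz by simp_all
  have np: "c_np C = (1 + q\<^sup>2) / q ^ 4"
  proof -
    have "(1 - q\<^sup>2) * c_np C = (1 - q\<^sup>2) * ((1 + q\<^sup>2) / q ^ 4)"
      using A Q0 by (simp add: field_simps power2_eq_square eval_nat_numeral)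
    then show ?thesis
      using Q1 by (simp add: times_divide_eq_right[symmetric] del: times_divide_eq_right)
  qed
  have nm: "c_nm C = -(1 + q\<^sup>2)"
  proof -
    have "(1 - q\<^sup>2) * c_nm C = (1 - q\<^sup>2) * (-(1 + q\<^sup>2))"
      using A by (simp add: field_simps eval_nat_numeral)
    then show ?thesis using Q1 by simp
  qed
  \<comment> \<open>For real r, \<open>E3\<close> becomes (1 + (1 - q^2) r)^2 = 1, factored here as
    a difference of squares.\<close>
  have "(1 - q\<^sup>2) * (c_r C * (2 + (1 - q\<^sup>2) * c_r C)) = 0"
    using E3 r by (simp add: algebra_simps)
  then have "c_r C = 0 \<or> 2 + (1 - q\<^sup>2) * c_r C = 0"
    using Q1 by (simp only: mult_eq_0_iff of_real_diff of_real_1 of_real_power) blast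
  then have "c_r C = 0 \<or> c_r C = 2 / (q\<^sup>2 - 1)"
    using Q1 by (auto simp: field_simps)
  then show ?thesis
    using m0 n0 np nm by (auto simp: braided_coeffs_def intro: coeffs.equality)
qed

section \<open>The explicit connections and their properties\<close>

definition nabla_of :: "coeffs \<Rightarrow> conn" where
  "nabla_of C = (\<lambda>\<xi>\<in>fmod q. \<lambda>(k, l). d q (\<xi> l) k \<boxplus> cst q (christ_coeff C l (k, l)) \<boxdot> \<xi> l)"

text \<open>Tailored to the solutions: the stay terms are omitted here, and \<open>nabla_of\<close>
  keeps only those terms of nabla e^l whose second factor is e^l, which for \<open>sol r\<close> is
  everything.\<close>

definition sigma_of :: "coeffs \<Rightarrow> braiding" where
  "sigma_of C = (\<lambda>\<omega>\<in>fmod q. \<lambda>(k, l). cst q (flip C l k) \<boxdot> \<omega> (l, k))"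

lemma nabla_of_apply:
  "\<xi> \<in> fmod q \<Longrightarrow> nabla_of C \<xi> (k, l) = d q (\<xi> l) k \<boxplus> cst q (christ_coeff C l (k, l)) \<boxdot> \<xi> l"
  by (simp add: nabla_of_def)

lemma sigma_of_apply:
  "\<omega> \<in> fmod q \<Longrightarrow> sigma_of C \<omega> (k, l) = cst q (flip C l k) \<boxdot> \<omega> (l, k)"
  by (simp add: sigma_of_def)

lemma nabla_of_closed: "nabla_of C \<in> fmod q \<rightarrow>\<^sub>E fmod q"
  by (auto simp: nabla_of_def fmod_def)

lemma sigma_of_closed: "sigma_of C \<in> fmod q \<rightarrow>\<^sub>E fmod q"
  by (auto simp: sigma_of_def fmod_def)

lemma flip_sol:
  fixes r :: complex
  shows "flip (sol r) E0 E0 = 1 + (1 - q\<^sup>2) * r" "flip (sol r) Ep E0 = 1 / q ^ 4"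
    "flip (sol r) Em E0 = q ^ 4"
  using q_nz by (simp_all add: braided_coeffs_def field_simps eval_nat_numeral)

lemma stay_sol: "stay (sol r) i j = 0"
  by (cases i; cases j) (simp_all add: braided_coeffs_def)

text \<open>The prescribed flips past e^+ and e^- are exactly the factors by which D_+ and D_-
  commute with the twists. This makes the right Leibniz rule hold in those components.\<close>

lemma flip_d_weight: "k \<noteq> E0 \<Longrightarrow> flip C l k = d_weight l k"
  by (cases k) (auto simp: d_weight_def eval_nat_numeral)

lemma flip_E0: "flip C l E0 = 1 + (1 - q\<^sup>2) * christ_coeff C l (E0, l)"
  by (cases l) auto

lemma christ_sol:
  "christ_coeff (sol r) i (k, l) = (if k = E0 \<and> l = i then christ_coeff (sol r) i (E0, i) else 0)"
  by (cases i; cases k; cases l) (simp_all add: braided_coeffs_def)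

lemma christ_sol_nonzero_index: "k \<noteq> E0 \<Longrightarrow> christ_coeff (sol r) l (k, m) = 0"
  by (subst christ_sol) simp

text \<open>The right Leibniz rule on e^l, read at e^k (x) e^l. For k = +, - the Christoffel term is
  absent and \<open>flip_d_weight\<close> decides.\<close>

lemma d_twist_compat:
  assumes "x \<in> S"
  shows "d q (twist q l x) k \<boxplus> cst q (christ_coeff (sol r) l (k, l)) \<boxdot> twist q l x =
    cst q (christ_coeff (sol r) l (k, l)) \<boxdot> twist q k (twist q l x) \<boxplus>
    cst q (flip (sol r) l k) \<boxdot> twist q l (d q x k)"
proof (cases "k = E0")
  case False
  then show ?thesis
    using assms by (simp add: christ_sol_nonzero_index flip_d_weight d_twist)
next
  case True
  let ?c = "christ_coeff (sol r) l (E0, l)" and ?y = "twist q l x" and ?D = "twist q l (d q x E0)"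
  have D: "d q ?y E0 = ?D"
    using d_twist[OF assms, of l E0] assms by (simp add: d_weight_def)
  \<comment> \<open>Replacing t_0 y by y + (q^2 - 1) D_0 y produces a D_0 term which the 1 - q^2
    part of the flip cancels; this fixes how sigma depends on nabla.\<close>
  have "cst q ?c \<boxdot> twist q E0 ?y \<boxplus> cst q (flip (sol r) l E0) \<boxdot> ?D =
      cst q ?c \<boxdot> ?y \<boxplus> (cst q (?c * (q\<^sup>2 - 1)) \<boxdot> ?D \<boxplus> cst q (1 + (1 - q\<^sup>2) * ?c) \<boxdot> ?D)"
    using assms
    by (simp add: twist_E0 D S.r_distr cst_mult_assoc flip_E0 S.a_assoc del: flip.simps)
  also have "\<dots> = cst q ?c \<boxdot> ?y \<boxplus> ?D"
    using assms by (simp add: cst_add_distrib algebra_simps)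
  finally show ?thesis
    using assms by (simp add: True D S.a_comm)
qed

lemma bimodule_conn_sol: "bimodule_conn q (nabla_of (sol r)) (sigma_of (sol r))"
proof -
  let ?n = "nabla_of (sol r)" and ?s = "sigma_of (sol r)"
  have 1: "?n (madd q \<xi> \<eta>) = madd q (?n \<xi>) (?n \<eta>)" if "\<xi> \<in> fmod q" "\<eta> \<in> fmod q" for \<xi> \<eta>
  proof (rule ext, clarify)
    fix k l
    show "?n (madd q \<xi> \<eta>) (k, l) = madd q (?n \<xi>) (?n \<eta>) (k, l)"
      using that fmodD[OF that(1)] fmodD[OF that(2)]
      by (simp add: nabla_of_apply) (simp add: madd_def nabla_of_apply d_add S.r_distr S.add.m_ac)
  qed
  have 2: "?n (lmul q x \<xi>) = madd q (tens q (d q x) \<xi>) (lmul q x (?n \<xi>))"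
    if "x \<in> S" "\<xi> \<in> fmod q" for x \<xi>
  proof (rule ext, clarify)
    fix k l
    show "?n (lmul q x \<xi>) (k, l) = madd q (tens q (d q x) \<xi>) (lmul q x (?n \<xi>)) (k, l)"
      using that fmodD[OF that(2)]
      by (simp add: nabla_of_apply)
        (simp add: madd_def lmul_def tens_def nabla_of_apply d_mult S.r_distr S.a_assoc
          cst_left_commute[of x])
  qed
  have 3: "?n (smul q z \<xi>) = smul q z (?n \<xi>)" if "\<xi> \<in> fmod q" for z \<xi>
  proof (rule ext, clarify)
    fix k l
    show "?n (smul q z \<xi>) (k, l) = smul q z (?n \<xi>) (k, l)"
      using that fmodD[OF that]
      by (simp add: smul_def 2) (simp add: madd_def lmul_def tens_def nabla_of_apply)
  qed
  have 4: "?s (madd q \<omega> \<rho>) = madd q (?s \<omega>) (?s \<rho>)" if "\<omega> \<in> fmod q" "\<rho> \<in> fmod q" for \<omega> \<rho>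
  proof (rule ext, clarify)
    fix k l
    show "?s (madd q \<omega> \<rho>) (k, l) = madd q (?s \<omega>) (?s \<rho>) (k, l)"
      using that fmodD[OF that(1)] fmodD[OF that(2)]
      by (simp add: sigma_of_apply) (simp add: madd_def sigma_of_apply S.r_distr)
  qed
  have 5: "?s (lmul q x \<omega>) = lmul q x (?s \<omega>)" if "x \<in> S" "\<omega> \<in> fmod q" for x \<omega>
  proof (rule ext, clarify)
    fix k l
    show "?s (lmul q x \<omega>) (k, l) = lmul q x (?s \<omega>) (k, l)"
      using that fmodD[OF that(2)]
      by (simp add: sigma_of_apply) (simp add: lmul_def sigma_of_apply cst_left_commute[of x])
  qed
  \<comment> \<open>The flip exchanges the order of the two twists, so right linearity is their
    commutation.\<close>
  have 6: "?s (rmul2 q \<omega> x) = rmul2 q (?s \<omega>) x" if "x \<in> S" "\<omega> \<in> fmod q" for x \<omega>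
  proof (rule ext, clarify)
    fix k l
    show "?s (rmul2 q \<omega> x) (k, l) = rmul2 q (?s \<omega>) x (k, l)"
      using that fmodD[OF that(2)]
      by (simp add: sigma_of_apply)
        (simp add: rmul2_def sigma_of_apply S.m_assoc twist_commute[of x k l])
  qed
  have 7: "?n (rmul q \<xi> x) = madd q (rmul2 q (?n \<xi>) x) (?s (tens q \<xi> (d q x)))"
    if "x \<in> S" "\<xi> \<in> fmod q" for x \<xi>
  proof (rule ext, clarify)
    fix k l
    note [simp] = that fmodD[OF that(2)]
    let ?c = "cst q (christ_coeff (sol r) l (k, l))"
    have "?n (rmul q \<xi> x) (k, l) = d q (\<xi> l) k \<boxdot> twist q k (twist q l x) \<boxplus>
        \<xi> l \<boxdot> (d q (twist q l x) k \<boxplus> ?c \<boxdot> twist q l x)"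
      by (simp add: nabla_of_apply)
        (simp add: rmul_def d_mult S.r_distr S.a_assoc cst_left_commute[of "\<xi> l"])
    also have "\<dots> = madd q (rmul2 q (?n \<xi>) x) (?s (tens q \<xi> (d q x))) (k, l)"
      \<comment> \<open>The Leibniz rule for D_k has put xi_l to the left of exactly the expression
        that \<open>d_twist_compat\<close> rewrites.\<close>
      unfolding d_twist_compat[OF that(1)]
      by (simp add: madd_def sigma_of_apply)
        (simp add: rmul2_def tens_def nabla_of_apply S.l_distr S.r_distr S.a_assoc S.m_assoc
          cst_left_commute[of "\<xi> l"])
    finally show "?n (rmul q \<xi> x) (k, l) = madd q (rmul2 q (?n \<xi>) x) (?s (tens q \<xi> (d q x))) (k, l)" .
  qed
  show ?thesis
    unfolding bimodule_conn_def
    by (intro conjI ballI allI nabla_of_closed sigma_of_closed 1 2 3 4 5 6 7)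
qed

lemma has_coeffs_sol: "has_coeffs q (sol r) (nabla_of (sol r)) (sigma_of (sol r))"
  unfolding has_coeffs_iff
proof (intro conjI allI; rule ext; clarify)
  fix i k l
  show "nabla_of (sol r) (bas q i) (k, l) = cfam (christ_coeff (sol r) i) (k, l)"
    by (simp add: nabla_of_apply)
      (simp add: bas_cfam cfam_def cst_mult christ_sol[of r i k l] christ_sol[of r l k l])
next
  fix i j k l
  show "sigma_of (sol r) (ee q i j) (k, l) = sigma_bas (sol r) i j (k, l)"
    unfolding ee_cfam sigma_of_apply[OF cfam_closed] sigma_bas_def
    unfolding cfam_def cst_mult stay_sol by (simp add: conj_commute del: flip.simps)
qed

lemma invariant_conn_sol: "invariant_conn q (nabla_of (sol r)) (sigma_of (sol r))"
  using bimodule_conn_sol has_coeffs_sol by (auto simp: invariant_conn_def)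

lemma preserves_sol:
  assumes "cnj r = r"
  shows "preserves q (nabla_of (sol r)) (diag_mat g)"
  unfolding preserves_iff[OF has_coeffs_sol] all_idx using assms by (simp add: braided_coeffs_def)

lemma torsion_compatible_sol: "torsion_compatible q (sigma_of (sol r))"
  unfolding torsion_compatible_def
proof (intro ballI ext)
  fix \<omega> :: "idx \<times> idx \<Rightarrow> alg" and c
  assume \<omega>: "\<omega> \<in> fmod q"
  then have s: "sigma_of (sol r) \<omega> \<in> fmod q"
    using sigma_of_closed by (simp add: PiE_iff)
  note [simp] = fmodD[OF \<omega>]
  \<comment> \<open>The shape of each two-form component: the flip of one mixed tensor cancels its
    own wedge factor, and the flip back, being inverse, cancels the other tensor.\<close>
  have cancel: "x \<boxplus> (cst q z \<boxdot> y \<boxplus> (cst q (- z) \<boxdot> y \<boxplus> cst q (- 1) \<boxdot> x)) = zer"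
    if "x \<in> S" "y \<in> S" for x y z
  proof -
    have "x \<boxplus> (cst q z \<boxdot> y \<boxplus> (cst q (- z) \<boxdot> y \<boxplus> cst q (- 1) \<boxdot> x)) =
        (x \<boxplus> cst q (- 1) \<boxdot> x) \<boxplus> (cst q z \<boxdot> y \<boxplus> cst q (- z) \<boxdot> y)"
      using that by (simp add: S.add.m_ac)
    then show ?thesis
      using that by (simp add: add_cst_mult cst_add_distrib)
  qed
  show "wedge q (madd q \<omega> (sigma_of (sol r) \<omega>)) c = mzero q c"
    using q_nz \<omega> s
    by (cases c; simp add: wedge_apply)
      (simp_all add: madd_def mzero_def sigma_of_apply flip_sol S.r_distr cst_mult_assoc
        S.a_assoc cancel
        del: flip.simps(3))
qed

text \<open>The whole content of star compatibility for a pure flip; it also shows that no flip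
  coefficient is zero, which gives the inverse of sigma.\<close>

lemma flip_sol_conj:
  fixes r :: complex
  assumes "(1 + (1 - q\<^sup>2) * r) * (1 + (1 - q\<^sup>2) * r) = 1" "cnj r = r"
  shows "flip (sol r) l k * cnj (flip (sol r) (conj_idx l) (conj_idx k)) = 1"
  using q_nz assms by (cases l; cases k) (simp_all add: flip_sol del: flip.simps(3))

lemma star_compatible_sol:
  fixes r :: complex
  assumes r: "(1 + (1 - q\<^sup>2) * r) * (1 + (1 - q\<^sup>2) * r) = 1" "cnj r = r"
  shows "star_compatible q (sigma_of (sol r))"
  unfolding star_compatible_def
proof
  let ?s = "sigma_of (sol r)"
  have nz: "flip (sol r) i j \<noteq> 0" for i j
    using flip_sol_conj[OF r, of i j] by auto
  \<comment> \<open>The inverse flip divides by the coefficient with the arguments in the opposite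
    order to those in \<open>sigma_of_apply\<close>.\<close>
  let ?g = "\<lambda>\<eta> (k, l). cst q (1 / flip (sol r) k l) \<boxdot> \<eta> (l, k)"
  show "bij_betw ?s (fmod q) (fmod q)"
  proof (rule bij_betwI[where g = ?g])
    show "?s \<in> fmod q \<rightarrow> fmod q" using sigma_of_closed by (auto simp: PiE_iff)
    show "?g \<in> fmod q \<rightarrow> fmod q" by (auto simp: fmod_def)
    fix \<omega> :: "idx \<times> idx \<Rightarrow> alg" assume \<omega>: "\<omega> \<in> fmod q"
    then have g: "?g \<omega> \<in> fmod q" by (auto simp: fmod_def)
    show "?g (?s \<omega>) = \<omega>"
      using nz fmodD[OF \<omega>] by (auto simp: fun_eq_iff sigma_of_apply[OF \<omega>] cst_mult_assoc)
    show "?s (?g \<omega>) = \<omega>"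
      using nz fmodD[OF \<omega>] by (auto simp: fun_eq_iff sigma_of_apply[OF g] cst_mult_assoc)
  qed
  show "\<forall>\<omega>\<in>fmod q. ?s (tau q (?s \<omega>)) = tau q \<omega>"
  proof (intro ballI ext, clarify)
    fix \<omega> :: "idx \<times> idx \<Rightarrow> alg" and k l
    assume \<omega>: "\<omega> \<in> fmod q"
    note [simp] = fmodD[OF \<omega>]
    have s: "?s \<omega> \<in> fmod q" using sigma_of_closed \<omega> by (simp add: PiE_iff)
    have t: "tau q (?s \<omega>) \<in> fmod q"
      using fmodD[OF s] by (auto simp: fmod_def tau_apply[OF s])
    have "flip (sol r) l k * (star_coeff (conj_idx l) * star_coeff (conj_idx k) *
        cnj (flip (sol r) (conj_idx l) (conj_idx k))) =
        star_coeff (conj_idx k) * star_coeff (conj_idx l)"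
      using flip_sol_conj[OF r, of l k] by (metis mult.assoc mult.commute mult.right_neutral)
    moreover have "?s (tau q (?s \<omega>)) (k, l) = cst q (flip (sol r) l k *
        (star_coeff (conj_idx l) * star_coeff (conj_idx k) *
          cnj (flip (sol r) (conj_idx l) (conj_idx k)))) \<boxdot>
        twist q k (twist q l (star q (\<omega> (conj_idx l, conj_idx k))))"
      by (simp add: sigma_of_apply[OF t] sigma_of_apply[OF \<omega>] tau_apply[OF s]
          star_cst_mult cst_mult_assoc twist_commute[of _ l k])
    ultimately show "?s (tau q (?s \<omega>)) (k, l) = tau q \<omega> (k, l)"
      by (simp only: tau_apply[OF \<omega>])
  qed
qed

text \<open>Both sides reverse the three factors and exchange each pair once, so the same three
  scalars are multiplied in different orders.\<close>

lemma braid_relation_sol: "braid_relation q (sigma_of (sol r))"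
  unfolding braid_relation_def
proof (intro ballI ext, clarify)
  fix \<omega> :: "idx \<times> idx \<times> idx \<Rightarrow> alg" and i j k
  assume \<omega>: "\<omega> \<in> fmod q"
  note bh = bimodule_conn_sol[of r] has_coeffs_sol[of r]
  note c = sigma_id_closed[OF bh] id_sigma_closed[OF bh]
  let ?s12 = "sigma_id q (sigma_of (sol r))" and ?s23 = "id_sigma q (sigma_of (sol r))"
  show "?s12 (?s23 (?s12 \<omega>)) (i, j, k) = ?s23 (?s12 (?s23 \<omega>)) (i, j, k)"
    using fmodD[OF \<omega>]
    by (simp add: sigma_id_apply[OF bh] id_sigma_apply[OF bh] c \<omega> stay_sol cst_mult_assoc mult_ac
        del: flip.simps)
qed

lemma braided_conns_sol:
  fixes r :: complex
  assumes "(1 + (1 - q\<^sup>2) * r) * (1 + (1 - q\<^sup>2) * r) = 1" "cnj r = r"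
  shows "(nabla_of (sol r), sigma_of (sol r)) \<in> braided_conns q (diag_mat g)"
  using invariant_conn_sol preserves_sol[OF assms(2)] torsion_compatible_sol
    star_compatible_sol[OF assms] braid_relation_sol
  by (simp add: braided_conns_def)

lemma eigenvector_cfam:
  assumes "bimodule_conn q nabla \<sigma>" "has_coeffs q (sol r) nabla \<sigma>"
    and "f p \<noteq> 0" "\<forall>k l. flip (sol r) l k * f (l, k) = z * f (k, l)"
  shows "eigenvector q \<sigma> (cfam f) z"
  using assms(3,4) unfolding eigenvector_def sigma_cfam[OF assms(1,2)] stay_sol smul_cfam mzero_cfam
  by (cases p) (auto simp: cfam_eq_iff simp del: flip.simps)

text \<open>The exterior derivative of e^0 is q^3 times e^+ wedge e^-, while nu = mu = 0 removes
  this two-form from the wedge of nabla e^0.\<close>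

lemma not_torsion_free:
  assumes C: "has_coeffs q (sol r) nabla \<sigma>"
  shows "\<not> torsion_free q nabla"
proof
  assume "torsion_free q nabla"
  then have t: "torsion q nabla (bas q E0) Epm = zer"
    by (simp add: torsion_free_def mzero_def)
  have n: "nabla (bas q E0) = cfam (christ_coeff (sol r) E0)"
    using C by (simp add: has_coeffs_iff)
  have "d q (bas q E0 i) = mzero q" for i
    by (auto simp: bas_def mzero_def fun_eq_iff)
  then have w: "wedge q (tens q (d q (bas q E0 i)) (bas q i)) Epm = zer" for i
    by (simp add: wedge_apply) (simp add: tens_def mzero_def fmodD)
  have "madd q (wedge q (tens q (d q (bas q E0 i)) (bas q i))) (lmul q (bas q E0 i) (d1_bas q i)) Epm =
      (if i = E0 then cst q (q ^ 3) else zer)" for i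
    unfolding madd_def w by (cases i) (simp_all add: lmul_def smul_def bas_def)
  then have "d1 q (bas q E0) Epm = cst q (q ^ 3)"
    unfolding d1_def by (subst msum_single[of _ _ E0]) (auto simp del: d1_bas.simps)
  moreover have "wedge q (nabla (bas q E0)) Epm = zer"
    unfolding n by (simp add: wedge_apply) (simp add: cfam_def braided_coeffs_def)
  ultimately have "cst q (- (q ^ 3)) = zer"
    using t by (simp add: torsion_def mdiff_def a_minus_def cst_minus)
  then show False using q_nz by (simp add: cst_eq_zero_iff)
qed

lemma braided_conns_obtain:
  assumes "q\<^sup>2 \<noteq> 1" "\<forall>i. g i \<noteq> 0" "(nabla, \<sigma>) \<in> braided_conns q (diag_mat g)"
  obtains r where "r = 0 \<or> r = 2 / (q\<^sup>2 - 1)" "bimodule_conn q nabla \<sigma>" "has_coeffs q (sol r) nabla \<sigma>"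
proof -
  obtain C where C: "has_coeffs q C nabla \<sigma>" and conn: "bimodule_conn q nabla \<sigma>"
    using assms(3) by (auto simp: braided_conns_def invariant_conn_def)
  from coeffs_necessary[OF assms C] show ?thesis
    using that[of 0] that[of "2 / (q\<^sup>2 - 1)"] C conn by auto
qed

lemma braided_conns_eq:
  assumes "q\<^sup>2 \<noteq> 1" "\<forall>i. g i \<noteq> 0"
  shows "braided_conns q (diag_mat g) =
    {(nabla_of (sol 0), sigma_of (sol 0)),
     (nabla_of (sol (2 / (q\<^sup>2 - 1))), sigma_of (sol (2 / (q\<^sup>2 - 1))))}"
proof -
  have Q: "(complex_of_real q)\<^sup>2 - 1 \<noteq> 0"
    using assms(1) by (metis of_real_1 of_real_eq_iff of_real_power right_minus_eq)
  \<comment> \<open>For the second value of r the flip of e^0 past itself is 1 - 2 = -1, whose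
    square is 1 as for r = 0.\<close>
  have "(1 - (complex_of_real q)\<^sup>2) * (2 / (q\<^sup>2 - 1)) = -2"
    using Q by (simp add: field_simps)
  then have "(nabla_of (sol r), sigma_of (sol r)) \<in> braided_conns q (diag_mat g)"
    if "r \<in> {0, 2 / (q\<^sup>2 - 1)}" for r :: complex
    using that by (intro braided_conns_sol) auto
  moreover have "nabla = nabla_of (sol r) \<and> \<sigma> = sigma_of (sol r)"
    if "bimodule_conn q nabla \<sigma>" "has_coeffs q (sol r) nabla \<sigma>" for nabla \<sigma> r
    using conn_eqI[OF that(1) bimodule_conn_sol that(2) has_coeffs_sol] .
  ultimately show ?thesis
    by (auto elim!: braided_conns_obtain[OF assms])
qed

text \<open>For i different from j the flips from (i, j) and (j, i) are inverse to each other, so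
  sigma squares to the identity on the span of e^i (x) e^j and e^j (x) e^i; the sums and differences
  listed are its eigenvectors there.\<close>

lemma eigenvectors_sol:
  fixes r :: complex
  assumes "bimodule_conn q nabla \<sigma>" "has_coeffs q (sol r) nabla \<sigma>"
  shows "eigenvector q \<sigma> (madd q (smul q (q\<^sup>2) (ee q Ep Em)) (ee q Em Ep)) 1"
    "eigenvector q \<sigma> (mdiff q (smul q (q\<^sup>2) (ee q Ep Em)) (ee q Em Ep)) (-1)"
    "eigenvector q \<sigma> (madd q (smul q (q\<^sup>2) (ee q Ep E0)) (smul q (1 / q\<^sup>2) (ee q E0 Ep))) 1"
    "eigenvector q \<sigma> (mdiff q (smul q (q\<^sup>2) (ee q Ep E0)) (smul q (1 / q\<^sup>2) (ee q E0 Ep))) (-1)"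
    "eigenvector q \<sigma> (madd q (smul q (q ^ 4) (ee q E0 Em)) (ee q Em E0)) 1"
    "eigenvector q \<sigma> (mdiff q (smul q (q ^ 4) (ee q E0 Em)) (ee q Em E0)) (-1)"
    "eigenvector q \<sigma> (ee q Ep Ep) (q\<^sup>2)"
    "eigenvector q \<sigma> (ee q Em Em) (1 / q\<^sup>2)"
    "eigenvector q \<sigma> (ee q E0 E0) (1 + (1 - q\<^sup>2) * r)"
  unfolding ee_cfam smul_cfam madd_cfam mdiff_cfam
  using q_nz
  \<comment> \<open>Each alternative supplies a basis tensor at which the vector is visibly
    nonzero.\<close>
  by - ((rule eigenvector_cfam[OF assms, of _ "(Ep, Em)"] eigenvector_cfam[OF assms, of _ "(Ep, E0)"]
      eigenvector_cfam[OF assms, of _ "(E0, Em)"] eigenvector_cfam[OF assms, of _ "(Ep, Ep)"]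
      eigenvector_cfam[OF assms, of _ "(Em, Em)"] eigenvector_cfam[OF assms, of _ "(E0, E0)"];
    simp add: all_idx flip_sol field_simps eval_nat_numeral del: flip.simps(3); fail)+)

lemma nabla_of_sol_eq_iff: "nabla_of (sol r) = nabla_of (sol r') \<longleftrightarrow> r = r'"
proof
  assume "nabla_of (sol r) = nabla_of (sol r')"
  then have "cfam (christ_coeff (sol r) E0) = cfam (christ_coeff (sol r') E0)"
    using has_coeffs_sol[of r] has_coeffs_sol[of r'] by (simp add: has_coeffs_iff)
  from this[unfolded cfam_eq_iff, rule_format, of "(E0, E0)"] show "r = r'"
    by (simp add: braided_coeffs_def)
qed simp

end

section \<open>The limit q to 1\<close>

lemma eventually_qsu2: "\<forall>\<^sub>F p in at (1::real). qsu2 p \<and> p\<^sup>2 \<noteq> 1"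
  unfolding eventually_at qsu2_def
  \<comment> \<open>Within distance 1 of the point 1 the parameter is positive, which excludes 0 and
    -1.\<close>
  by (rule exI[of _ 1]) (auto simp: dist_real_def power2_eq_1_iff)

lemma coeffs_converge_sol_0: "coeffs_converge (\<lambda>p. braided_coeffs p 0) (at 1)"
proof -
  have "((\<lambda>p. complex_of_real ((1 + p\<^sup>2) / p ^ 4)) \<longlongrightarrow> complex_of_real ((1 + 1\<^sup>2) / 1 ^ 4)) (at 1)"
    by (intro tendsto_intros) simp_all
  moreover have "((\<lambda>p. complex_of_real (- (1 + p\<^sup>2))) \<longlongrightarrow> complex_of_real (- (1 + 1\<^sup>2))) (at 1)"
    by (intro tendsto_intros)
  ultimately show ?thesis
    unfolding coeffs_converge_def by (auto simp: braided_coeffs_def)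
qed

text \<open>On the second branch r (p^2 - 1) is constantly 2, whereas a convergent r makes this
  product tend to 0; the bound 2 on its norm therefore excludes the branch near 1.\<close>

lemma coeffs_converge_iff:
  assumes "\<forall>\<^sub>F p in at 1. C p = braided_coeffs p 0 \<or> C p = braided_coeffs p (2 / (p\<^sup>2 - 1))"
  shows "coeffs_converge C (at 1) \<longleftrightarrow> (\<forall>\<^sub>F p in at 1. c_r (C p) = 0)"
proof
  assume "coeffs_converge C (at 1)"
  then obtain L where "((\<lambda>p. c_r (C p)) \<longlongrightarrow> L) (at 1)"
    by (auto simp: coeffs_converge_def)
  then have "((\<lambda>p. c_r (C p) * complex_of_real (p\<^sup>2 - 1)) \<longlongrightarrow> L * complex_of_real (1\<^sup>2 - 1)) (at 1)"
    by (intro tendsto_intros)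
  then have "\<forall>\<^sub>F p in at 1. norm (c_r (C p) * complex_of_real (p\<^sup>2 - 1)) < 2"
    by (intro order_tendstoD[of _ 0]) (auto dest: tendsto_norm)
  then show "\<forall>\<^sub>F p in at 1. c_r (C p) = 0"
    using assms eventually_qsu2
  proof eventually_elim
    case (elim p)
    have "C p \<noteq> braided_coeffs p (2 / (p\<^sup>2 - 1))"
    proof
      assume "C p = braided_coeffs p (2 / (p\<^sup>2 - 1))"
      moreover have "complex_of_real (p\<^sup>2 - 1) \<noteq> 0"
        using elim(3) by (simp only: of_real_eq_0_iff) simp
      ultimately have "c_r (C p) * complex_of_real (p\<^sup>2 - 1) = 2"
        by (simp add: braided_coeffs_def field_simps)
      then show False using elim(1) by simp
    qed
    then show ?case
      using elim(2) by (simp add: braided_coeffs_def)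
  qed
next
  assume "\<forall>\<^sub>F p in at 1. c_r (C p) = 0"
  \<comment> \<open>The two branches differ in r only, so a vanishing r identifies the coefficients
    on either of them.\<close>
  then have *: "\<forall>\<^sub>F p in at 1. C p = braided_coeffs p 0"
    using assms by eventually_elim (auto simp: braided_coeffs_def)
  show "coeffs_converge C (at 1)"
    unfolding coeffs_converge_def
  proof
    fix f :: "coeffs \<Rightarrow> complex" assume "f \<in> {c_r, c_nu, c_mu, c_np, c_nm, c_mp, c_mm}"
    then obtain L where L: "((\<lambda>p. f (braided_coeffs p 0)) \<longlongrightarrow> L) (at 1)"
      using coeffs_converge_sol_0 unfolding coeffs_converge_def by blast
    have "\<forall>\<^sub>F p in at 1. f (braided_coeffs p 0) = f (C p)"
      using * by eventually_elim simp
    from Lim_transform_eventually[OF L this] show "\<exists>L. ((\<lambda>p. f (C p)) \<longlongrightarrow> L) (at 1)" ..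
  qed
qed

text \<open>The limit clause concerns arbitrary families: the metric and the sign of the flip of e^0
  past itself may be chosen anew at every parameter, so families that mix both branches are covered
  as well.\<close>

theorem corollary6p2p4:
  fixes q :: real and g :: "idx \<Rightarrow> real"
  assumes "q \<noteq> 0" and "q\<^sup>2 \<noteq> 1" and "\<forall>i. g i \<noteq> 0"
  shows
    "(\<exists>nabla0 \<sigma>0 nabla1 \<sigma>1.
        nabla0 \<noteq> nabla1 \<and>
        braided_conns q (diag_mat g) = {(nabla0, \<sigma>0), (nabla1, \<sigma>1)} \<and>
        has_coeffs q \<lparr>c_r = 0, c_nu = 0, c_mu = 0,
          c_np = (1 + q\<^sup>2) / q ^ 4, c_nm = -(1 + q\<^sup>2), c_mp = 0, c_mm = 0\<rparr> nabla0 \<sigma>0 \<and>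
        has_coeffs q \<lparr>c_r = 2 / (q\<^sup>2 - 1), c_nu = 0, c_mu = 0,
          c_np = (1 + q\<^sup>2) / q ^ 4, c_nm = -(1 + q\<^sup>2), c_mp = 0, c_mm = 0\<rparr> nabla1 \<sigma>1 \<and>
        eigenvector q \<sigma>0 (ee q E0 E0) 1 \<and>
        eigenvector q \<sigma>1 (ee q E0 E0) (-1)) \<and>
     (\<forall>(nabla, \<sigma>) \<in> braided_conns q (diag_mat g).
        eigenvector q \<sigma> (madd q (smul q (q\<^sup>2) (ee q Ep Em)) (ee q Em Ep)) 1 \<and>
        eigenvector q \<sigma> (mdiff q (smul q (q\<^sup>2) (ee q Ep Em)) (ee q Em Ep)) (-1) \<and>
        eigenvector q \<sigma> (madd q (smul q (q\<^sup>2) (ee q Ep E0)) (smul q (1 / q\<^sup>2) (ee q E0 Ep))) 1 \<and>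
        eigenvector q \<sigma> (mdiff q (smul q (q\<^sup>2) (ee q Ep E0)) (smul q (1 / q\<^sup>2) (ee q E0 Ep))) (-1) \<and>
        eigenvector q \<sigma> (madd q (smul q (q ^ 4) (ee q E0 Em)) (ee q Em E0)) 1 \<and>
        eigenvector q \<sigma> (mdiff q (smul q (q ^ 4) (ee q E0 Em)) (ee q Em E0)) (-1) \<and>
        eigenvector q \<sigma> (ee q Ep Ep) (q\<^sup>2) \<and>
        eigenvector q \<sigma> (ee q Em Em) (1 / q\<^sup>2) \<and>
        \<not> torsion_free q nabla) \<and>
     (\<forall>G C.
        (\<forall>\<^sub>F p in at 1. (\<forall>i. G p i \<noteq> 0) \<and>
           (\<exists>(nabla, \<sigma>) \<in> braided_conns p (diag_mat (G p)). has_coeffs p (C p) nabla \<sigma>)) \<longrightarrow>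
        (coeffs_converge C (at 1) \<longleftrightarrow> (\<forall>\<^sub>F p in at 1. c_r (C p) = 0)))"
proof (intro conjI allI impI)
  interpret qsu2 q by unfold_locales (rule assms(1))
  have Q: "(complex_of_real q)\<^sup>2 - 1 \<noteq> 0"
    using assms(2) by (metis of_real_1 of_real_eq_iff of_real_power right_minus_eq)
  let ?r = "2 / ((complex_of_real q)\<^sup>2 - 1)"
  let ?C0 = "braided_coeffs q 0" and ?C1 = "braided_coeffs q ?r"
  show "\<exists>nabla0 \<sigma>0 nabla1 \<sigma>1.
        nabla0 \<noteq> nabla1 \<and>
        braided_conns q (diag_mat g) = {(nabla0, \<sigma>0), (nabla1, \<sigma>1)} \<and>
        has_coeffs q \<lparr>c_r = 0, c_nu = 0, c_mu = 0,
          c_np = (1 + q\<^sup>2) / q ^ 4, c_nm = -(1 + q\<^sup>2), c_mp = 0, c_mm = 0\<rparr> nabla0 \<sigma>0 \<and>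
        has_coeffs q \<lparr>c_r = 2 / (q\<^sup>2 - 1), c_nu = 0, c_mu = 0,
          c_np = (1 + q\<^sup>2) / q ^ 4, c_nm = -(1 + q\<^sup>2), c_mp = 0, c_mm = 0\<rparr> nabla1 \<sigma>1 \<and>
        eigenvector q \<sigma>0 (ee q E0 E0) 1 \<and>
        eigenvector q \<sigma>1 (ee q E0 E0) (-1)"
  proof (intro exI conjI)
    show "nabla_of ?C0 \<noteq> nabla_of ?C1"
      using Q by (simp add: nabla_of_sol_eq_iff)
    show "braided_conns q (diag_mat g) = {(nabla_of ?C0, sigma_of ?C0), (nabla_of ?C1, sigma_of ?C1)}"
      using braided_conns_eq[OF assms(2,3)] by simp
    show "has_coeffs q \<lparr>c_r = 0, c_nu = 0, c_mu = 0,
          c_np = (1 + q\<^sup>2) / q ^ 4, c_nm = -(1 + q\<^sup>2), c_mp = 0, c_mm = 0\<rparr> (nabla_of ?C0) (sigma_of ?C0)"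
      using has_coeffs_sol[of 0] by (simp add: braided_coeffs_def)
    show "has_coeffs q \<lparr>c_r = 2 / (q\<^sup>2 - 1), c_nu = 0, c_mu = 0,
          c_np = (1 + q\<^sup>2) / q ^ 4, c_nm = -(1 + q\<^sup>2), c_mp = 0, c_mm = 0\<rparr> (nabla_of ?C1) (sigma_of ?C1)"
      using has_coeffs_sol[of ?r] by (simp add: braided_coeffs_def)
    show "eigenvector q (sigma_of ?C0) (ee q E0 E0) 1"
      using eigenvectors_sol(9)[OF bimodule_conn_sol has_coeffs_sol, of 0] by simp
    have e: "1 + (1 - q\<^sup>2) * ?r = -1"
      using Q by (simp add: field_simps)
    show "eigenvector q (sigma_of ?C1) (ee q E0 E0) (-1)"
      using eigenvectors_sol(9)[OF bimodule_conn_sol has_coeffs_sol, of ?r]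
      by (simp only: e)
  qed
  show "\<forall>(nabla, \<sigma>) \<in> braided_conns q (diag_mat g).
        eigenvector q \<sigma> (madd q (smul q (q\<^sup>2) (ee q Ep Em)) (ee q Em Ep)) 1 \<and>
        eigenvector q \<sigma> (mdiff q (smul q (q\<^sup>2) (ee q Ep Em)) (ee q Em Ep)) (-1) \<and>
        eigenvector q \<sigma> (madd q (smul q (q\<^sup>2) (ee q Ep E0)) (smul q (1 / q\<^sup>2) (ee q E0 Ep))) 1 \<and>
        eigenvector q \<sigma> (mdiff q (smul q (q\<^sup>2) (ee q Ep E0)) (smul q (1 / q\<^sup>2) (ee q E0 Ep))) (-1) \<and>
        eigenvector q \<sigma> (madd q (smul q (q ^ 4) (ee q E0 Em)) (ee q Em E0)) 1 \<and>
        eigenvector q \<sigma> (mdiff q (smul q (q ^ 4) (ee q E0 Em)) (ee q Em E0)) (-1) \<and>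
        eigenvector q \<sigma> (ee q Ep Ep) (q\<^sup>2) \<and>
        eigenvector q \<sigma> (ee q Em Em) (1 / q\<^sup>2) \<and>
        \<not> torsion_free q nabla"
  proof clarify
    fix nabla \<sigma> assume "(nabla, \<sigma>) \<in> braided_conns q (diag_mat g)"
    then obtain r where r: "bimodule_conn q nabla \<sigma>" "has_coeffs q (braided_coeffs q r) nabla \<sigma>"
      by (rule braided_conns_obtain[OF assms(2,3)])
    show "eigenvector q \<sigma> (madd q (smul q (q\<^sup>2) (ee q Ep Em)) (ee q Em Ep)) 1 \<and>
        eigenvector q \<sigma> (mdiff q (smul q (q\<^sup>2) (ee q Ep Em)) (ee q Em Ep)) (-1) \<and>
        eigenvector q \<sigma> (madd q (smul q (q\<^sup>2) (ee q Ep E0)) (smul q (1 / q\<^sup>2) (ee q E0 Ep))) 1 \<and>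
        eigenvector q \<sigma> (mdiff q (smul q (q\<^sup>2) (ee q Ep E0)) (smul q (1 / q\<^sup>2) (ee q E0 Ep))) (-1) \<and>
        eigenvector q \<sigma> (madd q (smul q (q ^ 4) (ee q E0 Em)) (ee q Em E0)) 1 \<and>
        eigenvector q \<sigma> (mdiff q (smul q (q ^ 4) (ee q E0 Em)) (ee q Em E0)) (-1) \<and>
        eigenvector q \<sigma> (ee q Ep Ep) (q\<^sup>2) \<and>
        eigenvector q \<sigma> (ee q Em Em) (1 / q\<^sup>2) \<and>
        \<not> torsion_free q nabla"
      by (intro conjI eigenvectors_sol(1-8)[OF r] not_torsion_free[OF r(2)])
  qed
next
  fix G C
  assume "\<forall>\<^sub>F p in at 1. (\<forall>i. G p i \<noteq> 0) \<and>
    (\<exists>(nabla, \<sigma>) \<in> braided_conns p (diag_mat (G p)). has_coeffs p (C p) nabla \<sigma>)"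
  then have "\<forall>\<^sub>F p in at 1. C p = braided_coeffs p 0 \<or> C p = braided_coeffs p (2 / (p\<^sup>2 - 1))"
    using eventually_qsu2
  proof eventually_elim
    case (elim p)
    \<comment> \<open>Necessity is applied at each parameter separately, with the metric belonging
      to that parameter.\<close>
    then show ?case
      using qsu2.coeffs_necessary[of p "G p"] by blast
  qed
  then show "coeffs_converge C (at 1) \<longleftrightarrow> (\<forall>\<^sub>F p in at 1. c_r (C p) = 0)"
    by (rule coeffs_converge_iff)
qed

end
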